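(* Let $1\le p<q<\infty$ and for each $n$ let $Z=Z_n$ be uniformly distributed in $\mathbb B_p^n$. Then $(n^{1/p-1/q}\|Z\|_q)_{n\in\mathbb N}$ satisfies an LDP on $\mathbb R$ with speed $n^{p/q}$ and good rate function \[ \mathcal I(z)=\begin{cases}\frac1p\big(z^q-M_p(q)\big)^{p/q} & z\ge M_p(q)^{1/q},\\ +\infty & \text{otherwise}.\end{cases} \]
   Context: $\|x\|_p=(\sum_i|x_i|^p)^{1/p}$, $\mathbb B_p^n=\{x\in\mathbb R^n:\|x\|_p\le1\}$, $M_p(q)=\frac{p^{q/p}}{q+1}\frac{\Gamma(1+\frac{q+1}{p})}{\Gamma(1+\frac1p)}$. A sequence of real random variables $(X_n)$ satisfies a large deviation principle (LDP) with speed $s(n)\to\infty$ and rate function $\mathcal I:\mathbb R\to[0,\infty]$ (lower semicontinuous) if for every Borel set $A$: $-\inf_{A^\circ}\mathcal I\le\liminf\frac1{s(n)}\log P(X_n\in A)\le\limsup\frac1{s(n)}\log P(X_n\in A)\le-\inf_{\overline A}\mathcal I$; it is good if its level sets are compact. *)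

theory Defs
  imports "HOL-Analysis.Analysis" "HOL-Probability.Probability"
begin

text \<open>Vectors in R^n are modelled as functions nat => real on the index set {..<n}
  (extensional elements of the product measure space).\<close>

definition lp_norm :: "nat \<Rightarrow> real \<Rightarrow> (nat \<Rightarrow> real) \<Rightarrow> real" where
  "lp_norm n p x = (\<Sum>i<n. \<bar>x i\<bar> powr p) powr (1 / p)"

definition lp_ball :: "nat \<Rightarrow> real \<Rightarrow> (nat \<Rightarrow> real) set" where
  "lp_ball n p = {x \<in> space (PiM {..<n} (\<lambda>_. lborel)). lp_norm n p x \<le> 1}"

definition unif_lp_ball :: "nat \<Rightarrow> real \<Rightarrow> (nat \<Rightarrow> real) measure" where
  "unif_lp_ball n p = uniform_measure (PiM {..<n} (\<lambda>_. lborel)) (lp_ball n p)"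

definition M_p :: "real \<Rightarrow> real \<Rightarrow> real" where
  "M_p p q = p powr (q / p) / (q + 1) * Gamma (1 + (q + 1) / p) / Gamma (1 + 1 / p)"

definition lower_semicont :: "(real \<Rightarrow> ereal) \<Rightarrow> bool" where
  "lower_semicont f \<longleftrightarrow> (\<forall>x. f x \<le> Liminf (at x) f)"

definition eln :: "real \<Rightarrow> ereal" where
  "eln x = (if x \<le> 0 then -\<infinity> else ereal (ln x))"

definition LDP :: "(nat \<Rightarrow> real measure) \<Rightarrow> (nat \<Rightarrow> real) \<Rightarrow> (real \<Rightarrow> ereal) \<Rightarrow> bool" where
  "LDP mu s I \<longleftrightarrow>
     (\<forall>x. 0 \<le> I x) \<and> lower_semicont I \<and>
     (\<forall>A \<in> sets borel.
        - (INF x\<in>interior A. I x) \<le> liminf (\<lambda>n. eln (measure (mu n) A) / ereal (s n)) \<and>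
        limsup (\<lambda>n. eln (measure (mu n) A) / ereal (s n)) \<le> - (INF x\<in>closure A. I x))"

definition good_rate :: "(real \<Rightarrow> ereal) \<Rightarrow> bool" where
  "good_rate I \<longleftrightarrow> (\<forall>c::real. compact {x. I x \<le> ereal c})"

definition rate_1p3 :: "real \<Rightarrow> real \<Rightarrow> real \<Rightarrow> ereal" where
  "rate_1p3 p q z = (if z \<ge> M_p p q powr (1 / q)
      then ereal (1 / p * (z powr q - M_p p q) powr (p / q)) else \<infinity>)"

end

theory Submission
  imports Defs "HOL-Real_Asymp.Real_Asymp"
begin

text \<open>
  Let \<open>g\<^sub>1, \<dots>, g\<^sub>n\<close> be independent with density proportional to \<open>exp (- \<bar>y\<bar> powr p / p)\<close>. A set that is
  invariant under positive scaling has the same probability under the uniform distribution on the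
  \<open>\<ell>\<^sub>p\<close>-ball and under the law of \<open>g\<close>, because the joint density of \<open>g\<close> is a mixture of indicators of
  \<open>\<ell>\<^sub>p\<close>-balls. As the uniform distribution gives the ball of radius \<open>\<sigma> < 1\<close> only mass \<open>\<sigma> ^ n\<close>, the tails of
  the rescaled \<open>\<ell>\<^sub>q\<close>-norm can be read off the ratio of the \<open>\<ell>\<^sub>q\<close>-norm and the \<open>\<ell>\<^sub>p\<close>-norm of \<open>g\<close>. Chernoff
  bounds show that \<open>\<Sum>i<n. \<bar>g\<^sub>i\<bar> powr p\<close> deviates from \<open>n\<close> only with probability \<open>exp (- c n)\<close>, which is
  negligible at speed \<open>n powr (p / q)\<close>. What remains is \<open>\<Sum>i<n. \<bar>g\<^sub>i\<bar> powr q\<close>, whose summands have the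
  stretched exponential tail \<open>exp (- t powr (p / q) / p)\<close>: the cheapest way for the sum to reach \<open>n x\<close>
  is a single summand of size \<open>n (x - M_p p q)\<close>.
\<close>

section \<open>Large deviation principles from tail asymptotics\<close>

text \<open>The same inequality p / q < 1 makes every error of order \<open>exp (- c n)\<close>
  harmless: the mass of the inner ball as well as the fluctuation of the denominator. Half-lines
  suffice for the full principle. The rate is infinite to the left of m =
  \<open>M_p p q powr (1 / q)\<close>, vanishes at m, and increases strictly from there onto the
  nonnegative reals. A set whose closure misses m is covered by two rays; a neighbourhood of a point
  x \<ge> m contains some [u, v) to the right of x, and its probability is a difference of two tails
  of different exponential order. Passing between the ball, the ratio and the two sums costs factors
  \<sigma> and \<beta> close to 1. They are paid for by moving from t to a nearby u whose rate is
  still on the required side of J. Such a u comes as a preimage under the strictly increasing rate,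
  so surjectivity takes the place of continuity.\<close>

lemma eln_div_le_iff:
  assumes "s > 0" shows "eln x / ereal s \<le> ereal (- J) \<longleftrightarrow> x \<le> exp (- (J * s))"
proof (cases "x \<le> 0")
  case True
  then have "x \<le> exp (- (J * s))" by (meson exp_ge_zero order_trans)
  then show ?thesis using True assms by (simp add: eln_def)
next
  case False
  then have x: "x > 0" by simp
  have "ln x / s \<le> - J \<longleftrightarrow> ln x \<le> - (J * s)" using assms by (simp add: field_simps)
  also have "\<dots> \<longleftrightarrow> x \<le> exp (- (J * s))" by (metis exp_le_cancel_iff exp_ln x)
  finally show ?thesis using x assms by (simp add: eln_def)
qed

text \<open>With the previous equivalence this replaces \<open>ereal\<close> logarithms by
  inequalities between reals. The convention for \<open>eln\<close> fits:
  \<open>-\<infinity>\<close> is below every bound, and no exponential is below a nonpositive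
  \<open>x\<close>.\<close>

lemma eln_div_ge_iff:
  assumes "s > 0" shows "ereal (- J) \<le> eln x / ereal s \<longleftrightarrow> exp (- (J * s)) \<le> x"
proof (cases "x \<le> 0")
  case True
  then have "\<not> exp (- (J * s)) \<le> x" by (meson exp_gt_zero not_le order_less_le_trans)
  then show ?thesis using True assms by (simp add: eln_def)
next
  case False
  then have x: "x > 0" by simp
  have "- J \<le> ln x / s \<longleftrightarrow> - (J * s) \<le> ln x" using assms by (simp add: field_simps)
  also have "\<dots> \<longleftrightarrow> exp (- (J * s)) \<le> x" using x by (simp add: ln_ge_iff)
  finally show ?thesis using x assms by (simp add: eln_def)
qed

text \<open>An arbitrarily small loss in the rate absorbs a factor 2, the price of a union of two
  events or of subtracting one event from another.\<close>

lemma eventually_half_exp_le: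
  assumes "filterlim s at_top sequentially" "(J::real) < K"
  shows "\<forall>\<^sub>F n in sequentially. 2 * exp (- (K * s n)) \<le> exp (- (J * s n))"
proof -
  have "\<forall>\<^sub>F n in sequentially. s n \<ge> ln 2 / (K - J)"
    using assms(1) by (simp add: filterlim_at_top)
  then show ?thesis
  proof eventually_elim
    case (elim n)
    then have "ln 2 \<le> (K - J) * s n" using assms(2) by (simp add: field_simps)
    then have "ln 2 - K * s n \<le> - (J * s n)" by (simp add: algebra_simps)
    then have "exp (ln 2 - K * s n) \<le> exp (- (J * s n))" by simp
    then show ?case by (simp add: exp_diff exp_minus field_simps)
  qed
qed

text \<open>The strict inequalities between \<open>J\<close> and \<open>f t\<close> leave every tail
  estimate an arbitrarily small loss. The bound for \<open>{..t}\<close> holds for all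
  \<open>J\<close>: deviations to the left are cheaper than any exponential at speed
  \<open>s\<close>, which gives the value \<open>\<infinity>\<close> there. \<open>f_onto\<close>
  encodes both continuity and unboundedness of \<open>f\<close>.\<close>

locale tail_asymptotics =
  fixes \<mu> :: "nat \<Rightarrow> real measure" and s :: "nat \<Rightarrow> real" and f :: "real \<Rightarrow> real" and m :: real
  assumes prob: "\<And>n. prob_space (\<mu> n)" and sets: "\<And>n. sets (\<mu> n) = sets borel"
    and s_top: "filterlim s at_top sequentially"
    and f_mono: "strict_mono_on {m..} f" and f_min: "f m = 0"
    and f_onto: "\<And>y. 0 \<le> y \<Longrightarrow> \<exists>b\<ge>m. f b = y"
    and upper_tail_le: "\<And>t J. m < t \<Longrightarrow> J < f t \<Longrightarrow>
      \<forall>\<^sub>F n in sequentially. measure (\<mu> n) {t..} \<le> exp (- (J * s n))"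
    and upper_tail_ge: "\<And>t J. m < t \<Longrightarrow> f t < J \<Longrightarrow>
      \<forall>\<^sub>F n in sequentially. exp (- (J * s n)) \<le> measure (\<mu> n) {t..}"
    and lower_tail_le: "\<And>t J. t < m \<Longrightarrow>
      \<forall>\<^sub>F n in sequentially. measure (\<mu> n) {..t} \<le> exp (- (J * s n))"
begin

definition rate :: "real \<Rightarrow> ereal" where
  "rate z = (if m \<le> z then ereal (f z) else \<infinity>)"

lemma f_less_iff: "m \<le> x \<Longrightarrow> m \<le> y \<Longrightarrow> f x < f y \<longleftrightarrow> x < y"
  using strict_mono_on_less[OF f_mono, of x y] by simp

lemma f_le_iff: "m \<le> x \<Longrightarrow> m \<le> y \<Longrightarrow> f x \<le> f y \<longleftrightarrow> x \<le> y"
  using strict_mono_on_less_eq[OF f_mono, of x y] by simp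

lemma rate_nonneg: "0 \<le> rate z"
  using f_le_iff[of m z] by (auto simp: rate_def f_min)

text \<open>With \<open>b\<close> the preimage of \<open>c\<close> the set is \<open>{m..b}\<close>.
  Besides goodness this yields lower semicontinuity, since complements of sublevel sets are
  open.\<close>

lemma compact_sublevel: "compact {z. rate z \<le> ereal c}"
proof (cases "c < 0")
  case True
  then have "{z. rate z \<le> ereal c} = {}"
    using order_trans[OF rate_nonneg] by (fastforce simp flip: zero_ereal_def)
  then show ?thesis by simp
next
  case False
  then obtain b where b: "b \<ge> m" "f b = c" using f_onto[of c] by auto
  then have "{z. rate z \<le> ereal c} = {m..b}"
    using f_le_iff[of _ b] by (auto simp: rate_def)
  then show ?thesis by simp
qed

lemma lower_semicont_rate: "lower_semicont rate"
  unfolding lower_semicont_def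
proof (intro allI)
  fix x show "rate x \<le> Liminf (at x) rate"
    unfolding le_Liminf_iff
  proof (intro allI impI)
    fix y assume y: "y < rate x"
    show "\<forall>\<^sub>F z in at x. y < rate z"
    proof (cases y)
      case (real c)
      have "open (- {z. rate z \<le> ereal c})"
        using compact_imp_closed[OF compact_sublevel] by auto
      moreover have "x \<in> - {z. rate z \<le> ereal c}" using y real by auto
      ultimately have "\<forall>\<^sub>F z in at x. z \<in> - {z. rate z \<le> ereal c}"
        by (simp add: eventually_at_topological) blast
      then show ?thesis by eventually_elim (auto simp: real)
    next
      case MInf
      then show ?thesis using rate_nonneg less_le_trans[of "-\<infinity>" 0] by (auto intro!: always_eventually)
    qed (use y in auto)
  qed
qed

text \<open>A positive infimum over the closure keeps \<open>A\<close> away from \<open>m\<close>,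
  where the rate is 0, and pushes the points of \<open>A\<close> above \<open>m\<close> beyond a
  point \<open>b\<close> with large \<open>f b\<close>. So \<open>A\<close> lies in two
  rays.\<close>

lemma upper_bound:
  assumes A: "A \<in> sets borel"
  shows "limsup (\<lambda>n. eln (measure (\<mu> n) A) / ereal (s n)) \<le> - (INF x\<in>closure A. rate x)"
proof -
  define R where "R = (INF x\<in>closure A. rate x)"
  have s_pos: "\<forall>\<^sub>F n in sequentially. s n > 0"
    using s_top by (simp add: filterlim_at_top_dense)
  have "limsup (\<lambda>n. eln (measure (\<mu> n) A) / ereal (s n)) \<le> - ereal J" if J: "ereal J < R" for J
  proof (rule Limsup_bounded)
    show "\<forall>\<^sub>F n in sequentially. eln (measure (\<mu> n) A) / ereal (s n) \<le> - ereal J"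
    proof (cases "J \<le> 0")
      case True
      from s_pos show ?thesis
      proof eventually_elim
        case (elim n)
        interpret prob_space "\<mu> n" by (rule prob)
        have "J * s n \<le> 0" using True elim by (simp add: mult_nonpos_nonneg)
        then have "exp (- (J * s n)) \<ge> 1" by simp
        then have "prob A \<le> exp (- (J * s n))" using prob_le_1[of A] by linarith
        then show ?case using eln_div_le_iff[OF elim, of _ J] by simp
      qed
    next
      case False
      \<comment> \<open>Three levels \<open>J < K < L\<close> below the infimum: \<open>L\<close>
        determines \<open>b\<close>, the tail bound at \<open>b\<close> then has rate
        \<open>K < f b\<close>, and the gap from \<open>K\<close> to \<open>J\<close> absorbs the
        sum over two rays.\<close>
      obtain K' where K': "ereal J < K'" "K' < R" using dense[OF J] by auto
      then obtain K where K: "J < K" "ereal K < R" by (cases K') auto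
      obtain L' where L': "ereal K < L'" "L' < R" using dense[OF K(2)] by auto
      then obtain L where L: "K < L" "ereal L < R" by (cases L') auto
      from f_onto[of L] obtain b where b: "b \<ge> m" "f b = L" using False K L by auto
      have "b > m" using b f_min False K L by (cases "b = m") auto
      have A_b: "x \<ge> b" if "x \<in> A" "x \<ge> m" for x
      proof -
        have "R \<le> rate x" unfolding R_def using that closure_subset by (intro INF_lower) auto
        then have "ereal L < rate x" using L(2) by (rule order_less_le_trans[rotated])
        then have "f b < f x" using that b by (simp add: rate_def)
        then show ?thesis using f_less_iff[of b x] that b by simp
      qed
      have "m \<notin> closure A"
      proof
        assume "m \<in> closure A"
        then have "R \<le> rate m" unfolding R_def by (intro INF_lower) auto
        then show False using L False K by (auto simp: rate_def f_min simp flip: zero_ereal_def)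
           (metis ereal_less(2) less_le_trans not_less order.strict_trans)
      qed
      then obtain e where e: "e > 0" "\<forall>y\<in>A. e \<le> dist y m"
        by (auto simp: closure_approachable not_less)
      have sub: "A \<subseteq> {..m - e} \<union> {b..}"
      proof
        fix x assume "x \<in> A"
        then show "x \<in> {..m - e} \<union> {b..}" using A_b[of x] e(2) by (cases "x \<ge> m") (auto simp: dist_real_def)
      qed
      have 1: "\<forall>\<^sub>F n in sequentially. measure (\<mu> n) {b..} \<le> exp (- (K * s n))"
        by (rule upper_tail_le) (use \<open>b > m\<close> b L in auto)
      have 2: "\<forall>\<^sub>F n in sequentially. measure (\<mu> n) {..m - e} \<le> exp (- (K * s n))"
        by (rule lower_tail_le) (use e in auto)
      from 1 2 eventually_half_exp_le[OF s_top K(1)] s_pos show ?thesis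
      proof eventually_elim
        case (elim n)
        interpret prob_space "\<mu> n" by (rule prob)
        have "prob A \<le> prob ({..m - e} \<union> {b..})" using sub by (intro finite_measure_mono) (auto simp: sets)
        also have "\<dots> \<le> prob {..m - e} + prob {b..}" by (intro measure_Un_le) (auto simp: sets)
        also have "\<dots> \<le> exp (- (J * s n))" using elim by linarith
        finally show ?case using eln_div_le_iff[OF elim(4), of _ J] by simp
      qed
    qed
  qed
  then have *: "ereal J \<le> - limsup (\<lambda>n. eln (measure (\<mu> n) A) / ereal (s n))" if "ereal J < R" for J
    using that by (metis ereal_uminus_le_reorder ereal_uminus_uminus)
  have "R \<le> - limsup (\<lambda>n. eln (measure (\<mu> n) A) / ereal (s n))"
  proof (rule dense_le)
    fix y assume "y < R"
    then show "y \<le> - limsup (\<lambda>n. eln (measure (\<mu> n) A) / ereal (s n))"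
      using * by (cases y) auto
  qed
  then show ?thesis unfolding R_def by (metis ereal_uminus_le_reorder ereal_uminus_uminus)
qed

text \<open>Just to the right of \<open>x\<close> there is an interval [u, v) inside
  \<open>A\<close>. As \<open>f\<close> increases strictly, the tail at \<open>v\<close> is
  exponentially smaller than the tail at \<open>u\<close>, so the interval carries almost the whole
  tail at \<open>u\<close>.\<close>

lemma lower_bound:
  assumes A: "A \<in> sets borel"
  shows "- (INF x\<in>interior A. rate x) \<le> liminf (\<lambda>n. eln (measure (\<mu> n) A) / ereal (s n))"
proof -
  have s_pos: "\<forall>\<^sub>F n in sequentially. s n > 0"
    using s_top by (simp add: filterlim_at_top_dense)
  let ?l = "liminf (\<lambda>n. eln (measure (\<mu> n) A) / ereal (s n))"
  have "- rate x \<le> ?l" if x: "x \<in> interior A" for x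
  proof (cases "m \<le> x")
    case True
    have "ereal (- J) \<le> ?l" if J: "f x < J" for J
    proof (rule Liminf_bounded)
      \<comment> \<open>Capping \<open>v\<close> at \<open>u0\<close> ensures
        \<open>f v \<le> J\<close>; continuity of \<open>f\<close> at \<open>x\<close> would serve
        the same purpose.\<close>
      obtain u0 where u0: "u0 \<ge> m" "f u0 = J"
        using f_onto[of J] J f_le_iff[of m x] f_min True by auto
      then have "x < u0" using J f_less_iff True by auto
      obtain e where e: "e > 0" "ball x e \<subseteq> A" using x by (auto simp: mem_interior)
      define v where "v = min (x + e / 2) u0"
      define u where "u = (x + v) / 2"
      have uv: "x < u" "u < v" "v \<le> u0" "v < x + e"
        using \<open>x < u0\<close> e(1) by (auto simp: u_def v_def)
      \<comment> \<open>\<open>K\<close> and \<open>L\<close> divide the gap between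
        \<open>f u\<close> and \<open>f v\<close> into thirds: \<open>K\<close> bounds the tail at
        \<open>u\<close> from below, \<open>L\<close> the tail at \<open>v\<close> from above, and
        \<open>K < L\<close> makes the latter at most half of the former.\<close>
      define K where "K = (2 * f u + f v) / 3"
      define L where "L = (f u + 2 * f v) / 3"
      have "f u < f v" "f v \<le> J" using f_less_iff[of u v] f_le_iff[of v u0] uv u0 True by auto
      then have KL: "f u < K" "K < L" "L < f v" "K < J" by (auto simp: K_def L_def)
      have 1: "\<forall>\<^sub>F n in sequentially. exp (- (K * s n)) \<le> measure (\<mu> n) {u..}"
        by (rule upper_tail_ge) (use uv True KL in auto)
      have 2: "\<forall>\<^sub>F n in sequentially. measure (\<mu> n) {v..} \<le> exp (- (L * s n))"
        by (rule upper_tail_le) (use uv True KL in auto)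
      from 1 2 eventually_half_exp_le[OF s_top KL(2)] eventually_half_exp_le[OF s_top KL(4)] s_pos
      show "\<forall>\<^sub>F n in sequentially. ereal (- J) \<le> eln (measure (\<mu> n) A) / ereal (s n)"
      proof eventually_elim
        case (elim n)
        interpret prob_space "\<mu> n" by (rule prob)
        have "{u..} - {v..} \<subseteq> A" using e(2) uv by (auto simp: dist_real_def subset_iff)
        then have "prob ({u..} - {v..}) \<le> prob A"
          using A by (intro finite_measure_mono) (auto simp: sets)
        moreover have "prob ({u..} - {v..}) = prob {u..} - prob {v..}"
          using uv by (intro finite_measure_Diff) (auto simp: sets)
        ultimately have "exp (- (J * s n)) \<le> prob A" using elim by linarith
        then show ?case using eln_div_ge_iff[OF elim(5), of J] by simp
      qed
    qed
    then have *: "- ?l \<le> ereal J" if "f x < J" for J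
      using that by (metis ereal_uminus_le_reorder uminus_ereal.simps(1))
    have "- ?l \<le> ereal (f x)"
    proof (rule dense_ge)
      fix y assume "ereal (f x) < y"
      then show "- ?l \<le> y" using * by (cases y) auto
    qed
    then show ?thesis using True by (simp add: rate_def ereal_uminus_le_reorder)
  qed (simp add: rate_def)
  then have "- ?l \<le> (INF x\<in>interior A. rate x)"
    by (intro INF_greatest) (simp add: ereal_uminus_le_reorder)
  then show ?thesis by (simp add: ereal_uminus_le_reorder)
qed

lemma LDP_rate: "LDP \<mu> s rate"
  using rate_nonneg lower_semicont_rate lower_bound upper_bound by (simp add: LDP_def)

lemma good_rate_rate: "good_rate rate"
  using compact_sublevel by (simp add: good_rate_def)

end

section \<open>The generalized Gaussian distribution\<close>

lemma nn_integral_Fubini_lborel: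
  assumes [measurable]: "case_prod f \<in> borel_measurable (borel \<Otimes>\<^sub>M borel)"
  shows "(\<integral>\<^sup>+x. \<integral>\<^sup>+y. f x y \<partial>(lborel :: real measure) \<partial>(lborel :: real measure)) = (\<integral>\<^sup>+y. \<integral>\<^sup>+x. f x y \<partial>lborel \<partial>lborel)"
  by (rule lborel_pair.Fubini'[symmetric]) (simp add: measurable_lborel2)

lemma nn_integral_exp_atLeast:
  "(\<integral>\<^sup>+u. ennreal (exp (- u)) * indicator {a..} u \<partial>lborel) = ennreal (exp (- a))"
proof -
  have "(\<integral>\<^sup>+u. ennreal (exp (- u)) * indicator {a..} u \<partial>lborel) = ennreal (0 - (- exp (- a)))"
  proof (rule nn_integral_FTC_atLeast)
    show "((\<lambda>x::real. - exp (- x)) \<longlongrightarrow> 0) at_top"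
      using tendsto_minus[OF filterlim_compose[OF exp_at_bot filterlim_uminus_at_bot_at_top]] by simp
  qed (auto intro!: derivative_eq_intros)
  then show ?thesis by simp
qed

text \<open>\<open>x * |x| powr s / (s + 1)\<close> is an antiderivative for both signs of x. The
  point 0 is left out of the derivative computation, which the fundamental theorem permits for a
  continuous antiderivative.\<close>

lemma nn_integral_abs_powr_Icc:
  assumes s: "s \<ge> 0" and r: "r \<ge> 0"
  shows "(\<integral>\<^sup>+x. ennreal (\<bar>x\<bar> powr s) * indicator {-r..r} x \<partial>lborel)
    = ennreal (2 * r powr (s + 1) / (s + 1))"
proof -
  let ?F = "\<lambda>x::real. x * \<bar>x\<bar> powr s / (s + 1)"
  have ders: "(?F has_vector_derivative \<bar>x\<bar> powr s) (at x)" if "x \<noteq> 0" for x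
  proof (cases "x > 0")
    case True
    have "((\<lambda>x. x * x powr s / (s + 1)) has_real_derivative (x powr s + s * x powr s) / (s + 1)) (at x)"
      using True s by (auto intro!: derivative_eq_intros simp: powr_diff)
    also have "(x powr s + s * x powr s) / (s + 1) = x powr s"
      using s by (simp add: divide_simps) (simp add: algebra_simps)
    finally have "((\<lambda>x. x * x powr s / (s + 1)) has_real_derivative x powr s) (at x)" .
    moreover have "\<forall>\<^sub>F y in nhds x. y > 0" using eventually_nhds_in_open[of "{0<..}" x] True by simp
    then have "\<forall>\<^sub>F y in nhds x. ?F y = y * y powr s / (s + 1)" by eventually_elim auto
    ultimately show ?thesis
      using True by (subst has_real_derivative_iff_has_vector_derivative[symmetric])
        (subst DERIV_cong_ev, auto)
  next
    case False
    then have x: "x < 0" using that by simp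
    have "((\<lambda>x. x * (-x) powr s / (s + 1)) has_real_derivative ((-x) powr s + s * (-x) powr s) / (s + 1)) (at x)"
      using x s by (auto intro!: derivative_eq_intros simp: powr_diff)
    also have "((-x) powr s + s * (-x) powr s) / (s + 1) = (-x) powr s"
      using s by (simp add: divide_simps) (simp add: algebra_simps)
    finally have "((\<lambda>x. x * (-x) powr s / (s + 1)) has_real_derivative (-x) powr s) (at x)" .
    moreover have "\<forall>\<^sub>F y in nhds x. y < 0" using eventually_nhds_in_open[of "{..<0}" x] x by simp
    then have "\<forall>\<^sub>F y in nhds x. ?F y = y * (-y) powr s / (s + 1)" by eventually_elim auto
    ultimately show ?thesis
      using x by (subst has_real_derivative_iff_has_vector_derivative[symmetric])
        (subst DERIV_cong_ev, auto)
  qed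
  have cont: "continuous_on {-r..r} ?F"
  \<comment> \<open>\<open>|x| powr 0\<close> jumps at the origin because
    \<open>0 powr 0 = 0\<close>; only the factor x makes \<open>?F\<close> continuous in that
    case.\<close>
  proof (cases "s = 0")
    case True
    have "?F = (\<lambda>x. x)" using True by (auto simp: fun_eq_iff)
    then show ?thesis by (simp only:) simp
  next
    case False
    then show ?thesis using s by (intro continuous_intros continuous_on_powr') auto
  qed
  have "((\<lambda>x. \<bar>x\<bar> powr s) has_integral (?F r - ?F (-r))) {-r..r}"
    using r by (intro fundamental_theorem_of_calculus_interior_strong[where S = "{0}"] ders cont) auto
  then have "(\<integral>\<^sup>+x. ennreal (indicator {-r..r} x * \<bar>x\<bar> powr s) \<partial>lborel) = ennreal (?F r - ?F (-r))"
    by (intro nn_integral_has_integral_lebesgue) auto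
  also have "?F r - ?F (-r) = 2 * r powr (s + 1) / (s + 1)"
    using r by (cases "r = 0") (simp_all add: powr_add)
  finally show ?thesis by (simp add: ennreal_mult'' ennreal_indicator mult.commute)
qed

text \<open>Layer cake: write the exponential as an integral of \<open>exp (- u)\<close> over \<open>u \<ge> \<kappa> * \<bar>x\<bar> powr p\<close>
  and integrate over \<open>x\<close> first.\<close>
lemma nn_integral_abs_powr_exp:
  assumes p: "p > 0" and k: "\<kappa> > 0" and s: "s \<ge> 0"
  shows "(\<integral>\<^sup>+x. ennreal (\<bar>x\<bar> powr s * exp (- (\<kappa> * \<bar>x\<bar> powr p))) \<partial>lborel)
    = ennreal (2 * \<kappa> powr (- ((s + 1) / p)) / (s + 1) * Gamma (1 + (s + 1) / p))"
proof -
  let ?f = "\<lambda>x u. ennreal (\<bar>x\<bar> powr s) * (ennreal (exp (- u)) * indicator {\<kappa> * \<bar>x\<bar> powr p..} u)"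
  let ?c = "2 * \<kappa> powr (- ((s + 1) / p)) / (s + 1)"
  have "(\<integral>\<^sup>+x. ennreal (\<bar>x\<bar> powr s * exp (- (\<kappa> * \<bar>x\<bar> powr p))) \<partial>lborel)
    = (\<integral>\<^sup>+x. \<integral>\<^sup>+u. ?f x u \<partial>lborel \<partial>lborel)"
    by (simp add: nn_integral_cmult nn_integral_exp_atLeast ennreal_mult)
  also have "\<dots> = (\<integral>\<^sup>+u. \<integral>\<^sup>+x. ?f x u \<partial>lborel \<partial>lborel)"
  proof (rule nn_integral_Fubini_lborel)
    have "case_prod ?f = (\<lambda>(x, u). ennreal (\<bar>x\<bar> powr s) * (ennreal (exp (- u)) *
       (if \<kappa> * \<bar>x\<bar> powr p \<le> u then 1 else 0)))"
      by (auto simp: fun_eq_iff)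
    then show "case_prod ?f \<in> borel_measurable (borel \<Otimes>\<^sub>M borel)" by simp
  qed
  \<comment> \<open>The unsimplified exponent and the division by \<open>exp u\<close> reproduce the
    integrand of \<open>Gamma_conv_nn_integral_real\<close>.\<close>
  also have "\<dots> = (\<integral>\<^sup>+u. ennreal ?c * ennreal (indicator {0..} u * u powr (1 + (s + 1) / p - 1) / exp u) \<partial>lborel)"
  proof (rule nn_integral_cong)
    fix u :: real
    show "(\<integral>\<^sup>+x. ?f x u \<partial>lborel) = ennreal ?c * ennreal (indicator {0..} u * u powr (1 + (s + 1) / p - 1) / exp u)"
    proof (cases "u \<ge> 0")
      case False
      then have "?f x u = 0" for x
      proof -
        have "\<kappa> * \<bar>x\<bar> powr p \<ge> 0" using k by simp
        then have "\<not> \<kappa> * \<bar>x\<bar> powr p \<le> u" using False by linarith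
        then show ?thesis by simp
      qed
      then have "(\<integral>\<^sup>+x. ?f x u \<partial>lborel) = 0" by (simp only: nn_integral_const) simp
      then show ?thesis using False by simp
    next
      case True
      define r where "r = (u / \<kappa>) powr (1 / p)"
      have "\<kappa> * \<bar>x\<bar> powr p \<le> u \<longleftrightarrow> x \<in> {-r..r}" for x
      proof -
        have "\<kappa> * \<bar>x\<bar> powr p \<le> u \<longleftrightarrow> \<bar>x\<bar> powr p \<le> r powr p"
          using k p True by (simp add: r_def powr_powr field_simps)
        also have "\<dots> \<longleftrightarrow> \<bar>x\<bar> \<le> r"
          using p powr_less_mono2[of p r "\<bar>x\<bar>"] powr_mono2[of p "\<bar>x\<bar>" r]
          by (auto simp: r_def not_less[symmetric] simp del: not_less)
        finally show ?thesis by (auto simp: abs_le_iff)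
      qed
      then have "?f x u = ennreal (exp (- u)) * (ennreal (\<bar>x\<bar> powr s) * indicator {-r..r} x)" for x
        by (auto simp: indicator_def mult.commute)
      then have "(\<integral>\<^sup>+x. ?f x u \<partial>lborel) = ennreal (exp (- u)) * ennreal (2 * r powr (s + 1) / (s + 1))"
        using s by (simp add: nn_integral_cmult nn_integral_abs_powr_Icc r_def)
      also have "r powr (s + 1) = \<kappa> powr (- ((s + 1) / p)) * u powr ((s + 1) / p)"
        using True k by (simp add: r_def powr_powr powr_divide powr_minus field_simps)
      finally show ?thesis using True s by (simp add: exp_minus field_simps flip: ennreal_mult)
    qed
  qed
  also have "\<dots> = ennreal ?c * ennreal (Gamma (1 + (s + 1) / p))"
    using s p Gamma_conv_nn_integral_real[of "1 + (s + 1) / p"]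
    by (subst nn_integral_cmult) (auto simp: add_pos_nonneg)
  also have "\<dots> = ennreal (?c * Gamma (1 + (s + 1) / p))"
    using s by (intro ennreal_mult'[symmetric]) simp
  finally show ?thesis .
qed

text \<open>The divisor is the total mass, the case s = 0, \<kappa> = 1 / p of
  \<open>nn_integral_abs_powr_exp\<close>. The factor 1 / p in the exponent normalises the p-th
  absolute moment to 1, see \<open>M_p_self\<close>.\<close>

definition gen_gaussian :: "real \<Rightarrow> real measure" where
  "gen_gaussian p = density lborel (\<lambda>x. ennreal (exp (- (\<bar>x\<bar> powr p / p)) / (2 * p powr (1 / p) * Gamma (1 + 1 / p))))"

lemma sets_gen_gaussian[simp, measurable_cong]: "sets (gen_gaussian p) = sets borel"
  and space_gen_gaussian[simp]: "space (gen_gaussian p) = UNIV"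
  by (simp_all add: gen_gaussian_def)

lemma gen_gaussian_const_pos: "p > 0 \<Longrightarrow> 2 * p powr (1 / p) * Gamma (1 + 1 / p) > (0::real)"
  by (intro mult_pos_pos Gamma_real_pos) (auto intro!: add_pos_pos)

text \<open>Tilting by \<open>exp (\<kappa> * |x| powr p)\<close> only lowers the coefficient 1 / p
  in the exponent of the density to 1 / p - \<kappa>, which \<open>p * \<kappa> < 1\<close> keeps
  positive. Plain moments and the remainder terms of the Chernoff bounds are both instances.\<close>

lemma nn_integral_gen_gaussian:
  assumes p: "p > 0" and s: "s \<ge> 0" and k: "p * \<kappa> < 1"
  shows "(\<integral>\<^sup>+x. ennreal (\<bar>x\<bar> powr s * exp (\<kappa> * \<bar>x\<bar> powr p)) \<partial>gen_gaussian p)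
    = ennreal ((1 / p - \<kappa>) powr (- ((s + 1) / p)) / (s + 1) * Gamma (1 + (s + 1) / p)
        / (p powr (1 / p) * Gamma (1 + 1 / p)))"
proof -
  define Z where "Z = 2 * p powr (1 / p) * Gamma (1 + 1 / p)"
  have Z: "Z > 0" using gen_gaussian_const_pos[OF p] by (simp add: Z_def)
  have k': "1 / p - \<kappa> > 0" using p k by (simp add: field_simps)
  have *: "exp (\<kappa> * \<bar>x\<bar> powr p) * exp (- (\<bar>x\<bar> powr p / p)) = exp (- ((1 / p - \<kappa>) * \<bar>x\<bar> powr p))" for x
    by (simp add: left_diff_distrib flip: exp_add)
  have **: "exp (- (\<bar>x\<bar> powr p / p)) / Z * (\<bar>x\<bar> powr s * exp (\<kappa> * \<bar>x\<bar> powr p))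
    = 1 / Z * (\<bar>x\<bar> powr s * exp (- ((1 / p - \<kappa>) * \<bar>x\<bar> powr p)))" for x
    unfolding *[symmetric] by (simp add: mult_ac)
  have "(\<integral>\<^sup>+x. ennreal (\<bar>x\<bar> powr s * exp (\<kappa> * \<bar>x\<bar> powr p)) \<partial>gen_gaussian p)
    = (\<integral>\<^sup>+x. ennreal (1 / Z) * ennreal (\<bar>x\<bar> powr s * exp (- ((1 / p - \<kappa>) * \<bar>x\<bar> powr p))) \<partial>lborel)"
    unfolding gen_gaussian_def Z_def[symmetric] using Z
  proof (subst nn_integral_density)
    show "(\<integral>\<^sup>+x. ennreal (exp (- (\<bar>x\<bar> powr p / p)) / Z) * ennreal (\<bar>x\<bar> powr s * exp (\<kappa> * \<bar>x\<bar> powr p)) \<partial>lborel)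
      = (\<integral>\<^sup>+x. ennreal (1 / Z) * ennreal (\<bar>x\<bar> powr s * exp (- ((1 / p - \<kappa>) * \<bar>x\<bar> powr p))) \<partial>lborel)"
      using Z ** by (intro nn_integral_cong) (simp flip: ennreal_mult del: times_divide_eq_left)
  qed simp_all
  also have "\<dots> = ennreal (1 / Z) * ennreal (2 * (1 / p - \<kappa>) powr (- ((s + 1) / p)) / (s + 1) * Gamma (1 + (s + 1) / p))"
    using p s k' by (subst nn_integral_cmult) (simp_all add: nn_integral_abs_powr_exp)
  also have "\<dots> = ennreal ((1 / Z) * (2 * (1 / p - \<kappa>) powr (- ((s + 1) / p)) / (s + 1) * Gamma (1 + (s + 1) / p)))"
    using Z by (intro ennreal_mult'[symmetric]) simp
  finally show ?thesis by (simp add: Z_def field_simps)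
qed

lemma prob_space_gen_gaussian:
  assumes "p > 0" shows "prob_space (gen_gaussian p)"
proof
  \<comment> \<open>\<open>0 powr 0 = 0\<close>, so the zeroth moment agrees with the total mass only almost everywhere.\<close>
  have "emeasure (gen_gaussian p) (space (gen_gaussian p)) =
    (\<integral>\<^sup>+x. ennreal (\<bar>x\<bar> powr 0 * exp (0 * \<bar>x\<bar> powr p)) \<partial>gen_gaussian p)"
  proof -
    have "AE x in lborel. x \<noteq> (0::real)" by (rule AE_lborel_singleton)
    then have "AE x in gen_gaussian p. x \<noteq> 0" unfolding gen_gaussian_def by (subst AE_density) auto
    then have "(\<integral>\<^sup>+x. ennreal (\<bar>x\<bar> powr 0 * exp (0 * \<bar>x\<bar> powr p)) \<partial>gen_gaussian p) = (\<integral>\<^sup>+x. 1 \<partial>gen_gaussian p)"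
      by (intro nn_integral_cong_AE) auto
    then show ?thesis by simp
  qed
  also have "\<dots> = 1"
  proof -
    have "Gamma (1 + 1 / p) \<noteq> 0" using gen_gaussian_const_pos[OF assms] by auto
    then show ?thesis using assms by (subst nn_integral_gen_gaussian) (auto simp: powr_divide powr_minus field_simps)
  qed
  finally show "emeasure (gen_gaussian p) (space (gen_gaussian p)) = 1" .
qed

lemma integrable_gen_gaussian:
  assumes "p > 0" "s \<ge> 0" "p * \<kappa> < 1"
  shows "integrable (gen_gaussian p) (\<lambda>x. \<bar>x\<bar> powr s * exp (\<kappa> * \<bar>x\<bar> powr p))"
  by (rule integrableI_nonneg) (simp_all add: nn_integral_gen_gaussian[OF assms])

lemma integrable_gen_gaussian_powr:
  assumes "p > 0" "s \<ge> 0" shows "integrable (gen_gaussian p) (\<lambda>x. \<bar>x\<bar> powr s)"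
  using integrable_gen_gaussian[OF assms, of 0] by simp

text \<open>Explains the constant in the rate function: \<open>psum n q x / n\<close> concentrates
  at \<open>M_p p q\<close> under \<open>gauss n p\<close>.\<close>

lemma integral_gen_gaussian_powr:
  assumes "p > 0" "s \<ge> 0" shows "(\<integral>x. \<bar>x\<bar> powr s \<partial>gen_gaussian p) = M_p p s"
proof -
  have G: "Gamma (1 + 1 / p) > 0" "Gamma (1 + (s + 1) / p) > 0"
    using assms by (auto intro!: Gamma_real_pos add_pos_nonneg)
  have "(\<integral>x. \<bar>x\<bar> powr s \<partial>gen_gaussian p) = enn2real (\<integral>\<^sup>+x. ennreal (\<bar>x\<bar> powr s * exp (0 * \<bar>x\<bar> powr p)) \<partial>gen_gaussian p)"
    by (subst integral_eq_nn_integral) auto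
  also have "\<dots> = (1 / p - 0) powr (- ((s + 1) / p)) / (s + 1) * Gamma (1 + (s + 1) / p)
        / (p powr (1 / p) * Gamma (1 + 1 / p))"
    using assms G by (subst nn_integral_gen_gaussian) (auto intro!: enn2real_ennreal)
  also have "(1 / p - 0) powr (- ((s + 1) / p)) = p powr (s / p) * p powr (1 / p)"
  proof -
    have "(1 / p) powr (- a) = p powr a" for a using assms by (simp add: powr_divide powr_minus)
    from this[of "(s + 1) / p"] show ?thesis by (simp add: add_divide_distrib flip: powr_add del: minus_add_distrib)
  qed
  finally show ?thesis using assms G by (simp add: M_p_def)
qed

text \<open>The functional equation of Gamma; hence \<open>psum n p\<close> is typically close to
  n.\<close>

lemma M_p_self: assumes "p > 0" shows "M_p p p = 1"
proof -
  have "1 + (p + 1) / p = (1 + 1 / p) + 1" using assms by (simp add: field_simps)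
  then have "Gamma (1 + (p + 1) / p) = (1 + 1 / p) * Gamma (1 + 1 / p)"
    using Gamma_plus1[of "1 + 1 / p"] nonpos_Ints_nonpos[of "1 + 1 / p"] assms
    by (smt (verit) add.commute add_pos_pos divide_pos_pos)
  moreover have "Gamma (1 + 1 / p) > 0" using assms by (intro Gamma_real_pos) (auto intro!: add_pos_pos)
  ultimately have "M_p p p = p / (p + 1) * (1 + 1 / p)" using assms by (simp add: M_p_def)
  also have "\<dots> = 1" using assms by (simp add: divide_simps)
  finally show ?thesis .
qed

lemma M_p_pos: assumes "p > 0" "s \<ge> 0" shows "M_p p s > 0"
  unfolding M_p_def using assms by (intro divide_pos_pos mult_pos_pos Gamma_real_pos) (auto intro!: add_pos_nonneg)

section \<open>Cones and the uniform distribution on the ball\<close>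

lemma indicator_PiE_eq_prod:
  assumes "finite I" "x \<in> extensional I"
  shows "(indicator (Pi\<^sub>E I A) x :: ennreal) = (\<Prod>i\<in>I. indicator (A i) (x i))"
proof (cases "x \<in> Pi\<^sub>E I A")
  case True
  then show ?thesis by (auto simp: PiE_iff intro!: prod.neutral[symmetric])
next
  case False
  then obtain i where "i \<in> I" "x i \<notin> A i" using assms(2) by (auto simp: PiE_iff)
  then have "(\<Prod>i\<in>I. indicator (A i) (x i) :: ennreal) = 0"
    using assms(1) by (intro prod_zero) (auto simp: indicator_def)
  then show ?thesis using False by simp
qed

lemma PiM_density:
  assumes I: "finite I" and M: "\<And>i. sigma_finite_measure (M i)"
    and N: "\<And>i. sigma_finite_measure (density (M i) (f i))"
    and f[measurable]: "\<And>i. f i \<in> borel_measurable (M i)"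
  shows "PiM I (\<lambda>i. density (M i) (f i)) = density (PiM I M) (\<lambda>x. \<Prod>i\<in>I. f i (x i))"
proof -
  interpret M: product_sigma_finite M by (rule product_sigma_finite.intro) (rule M)
  interpret N: product_sigma_finite "\<lambda>i. density (M i) (f i)" by (rule product_sigma_finite.intro) (rule N)
  show ?thesis
  proof (rule N.PiM_eqI[symmetric, OF I])
    show "sets (density (PiM I M) (\<lambda>x. \<Prod>i\<in>I. f i (x i))) = PiM I (\<lambda>i. density (M i) (f i))"
      by (simp cong: sets_PiM_cong)
    fix A assume A: "\<And>i. i \<in> I \<Longrightarrow> A i \<in> sets (density (M i) (f i))"
    then have A'[measurable]: "\<And>i. i \<in> I \<Longrightarrow> A i \<in> sets (M i)" by simp
    have "emeasure (density (PiM I M) (\<lambda>x. \<Prod>i\<in>I. f i (x i))) (Pi\<^sub>E I A)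
      = (\<integral>\<^sup>+x. (\<Prod>i\<in>I. f i (x i)) * indicator (Pi\<^sub>E I A) x \<partial>PiM I M)"
      using I by (subst emeasure_density) (auto intro!: sets_PiM_I_finite A')
    also have "\<dots> = (\<integral>\<^sup>+x. (\<Prod>i\<in>I. f i (x i) * indicator (A i) (x i)) \<partial>PiM I M)"
      using I by (intro nn_integral_cong) (auto simp: prod.distrib indicator_PiE_eq_prod space_PiM PiE_iff)
    also have "\<dots> = (\<Prod>i\<in>I. \<integral>\<^sup>+y. f i y * indicator (A i) y \<partial>M i)"
      using I by (intro M.product_nn_integral_prod) auto
    also have "\<dots> = (\<Prod>i\<in>I. emeasure (density (M i) (f i)) (A i))"
      by (intro prod.cong) (auto simp: emeasure_density)
    finally show "emeasure (density (PiM I M) (\<lambda>x. \<Prod>i\<in>I. f i (x i))) (Pi\<^sub>E I A)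
      = (\<Prod>i\<in>I. emeasure (density (M i) (f i)) (A i))" .
  qed
qed

text \<open>The n-dimensional change of variables follows from the one-dimensional one: preimages of
  boxes are boxes, and a product measure is determined by its values on boxes.\<close>

lemma PiM_lborel_scale:
  assumes I: "finite I" and r: "r > 0"
  shows "density (distr (PiM I (\<lambda>_. lborel)) (PiM I (\<lambda>_. lborel)) (\<lambda>x. \<lambda>i\<in>I. r * x i))
    (\<lambda>_. ennreal r ^ card I) = PiM I (\<lambda>_. lborel :: real measure)" (is "density (distr ?M ?M ?T) ?c = _")
proof -
  interpret product_sigma_finite "\<lambda>_::'a. lborel :: real measure" ..
  have T[measurable]: "?T \<in> ?M \<rightarrow>\<^sub>M ?M"
    by (intro measurable_restrict) measurable
  show ?thesis
  proof (rule PiM_eqI[OF I])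
    fix A :: "'a \<Rightarrow> real set"
    assume "\<And>i. i \<in> I \<Longrightarrow> A i \<in> sets lborel"
    then have A[measurable]: "\<And>i. i \<in> I \<Longrightarrow> A i \<in> sets borel" by simp
    have 1: "(*) r -` A i \<in> sets borel" if "i \<in> I" for i
      using measurable_sets_borel[of "(*) r" borel "A i"] that A by simp
    have scale: "emeasure lborel (A i) = ennreal r * emeasure lborel ((*) r -` A i)" if "i \<in> I" for i
    proof -
      have "emeasure lborel (A i) = emeasure (density (distr lborel borel ((*) r)) (\<lambda>_. ennreal \<bar>r\<bar>)) (A i)"
        using r by (subst lborel_distr_mult'[symmetric]) auto
      also have "\<dots> = ennreal r * emeasure lborel ((*) r -` A i)"
        using that A r by (subst emeasure_density) (auto simp: nn_integral_cmult_indicator emeasure_distr)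
      finally show ?thesis .
    qed
    have "emeasure (density (distr ?M ?M ?T) ?c) (Pi\<^sub>E I A) = ennreal r ^ card I * emeasure ?M (?T -` Pi\<^sub>E I A \<inter> space ?M)"
    proof -
      have "Pi\<^sub>E I A \<in> sets ?M" using I A by (intro sets_PiM_I_finite) auto
      then show ?thesis
        by (subst emeasure_density) (auto simp: nn_integral_cmult_indicator emeasure_distr)
    qed
    also have "?T -` Pi\<^sub>E I A \<inter> space ?M = Pi\<^sub>E I (\<lambda>i. (*) r -` A i)"
      by (auto simp: space_PiM PiE_iff extensional_def)
    also have "emeasure ?M \<dots> = (\<Prod>i\<in>I. emeasure lborel ((*) r -` A i))"
      using I 1 by (intro emeasure_PiM) auto
    also have "ennreal r ^ card I * \<dots> = (\<Prod>i\<in>I. emeasure lborel (A i))"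
      using scale by (simp add: prod.distrib cong: prod.cong)
    finally show "emeasure (density (distr ?M ?M ?T) ?c) (Pi\<^sub>E I A) = (\<Prod>i\<in>I. emeasure lborel (A i))" .
  qed simp
qed

lemma emeasure_PiM_lborel_scale:
  assumes "finite I" "r > 0" and A: "A \<in> sets (PiM I (\<lambda>_. lborel :: real measure))"
  shows "emeasure (PiM I (\<lambda>_. lborel)) A
    = ennreal r ^ card I * emeasure (PiM I (\<lambda>_. lborel)) {x \<in> space (PiM I (\<lambda>_. lborel)). (\<lambda>i\<in>I. r * x i) \<in> A}"
    (is "emeasure ?M A = _")
proof -
  have T: "(\<lambda>x. \<lambda>i\<in>I. r * x i) \<in> ?M \<rightarrow>\<^sub>M ?M"
    by (intro measurable_restrict) measurable
  have "emeasure ?M A = emeasure (density (distr ?M ?M (\<lambda>x. \<lambda>i\<in>I. r * x i)) (\<lambda>_. ennreal r ^ card I)) A"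
    using PiM_lborel_scale[OF assms(1,2)] by simp
  also have "\<dots> = ennreal r ^ card I * emeasure ?M ((\<lambda>x. \<lambda>i\<in>I. r * x i) -` A \<inter> space ?M)"
    using A T by (subst emeasure_density) (auto simp: nn_integral_cmult_indicator emeasure_distr)
  finally show ?thesis by (simp add: vimage_def Collect_conj_eq Int_commute)
qed

section \<open>Dilation-invariant events under both distributions\<close>

abbreviation leb :: "nat \<Rightarrow> (nat \<Rightarrow> real) measure" where
  "leb n \<equiv> PiM {..<n} (\<lambda>_. lborel)"

abbreviation gauss :: "nat \<Rightarrow> real \<Rightarrow> (nat \<Rightarrow> real) measure" where
  "gauss n p \<equiv> PiM {..<n} (\<lambda>_. gen_gaussian p)"

definition psum :: "nat \<Rightarrow> real \<Rightarrow> (nat \<Rightarrow> real) \<Rightarrow> real" where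
  "psum n p x = (\<Sum>i<n. \<bar>x i\<bar> powr p)"

lemma psum_nonneg[simp]: "0 \<le> psum n p x"
  by (simp add: psum_def sum_nonneg)

lemma psum_cong_PiM:
  "sets (gauss n p) = sets (leb n)" "space (gauss n p) = space (leb n)"
  by (auto intro!: sets_PiM_cong simp: space_PiM)

lemma measurable_psum[measurable]:
  "psum n s \<in> borel_measurable (leb n)" "psum n s \<in> borel_measurable (gauss n p)"
  unfolding psum_def by measurable

lemma psum_scale: "r \<ge> 0 \<Longrightarrow> psum n p (\<lambda>i\<in>{..<n}. r * x i) = r powr p * psum n p x"
  by (simp add: psum_def abs_mult powr_mult sum_distrib_left)

lemma gauss_eq_density:
  assumes "p > 0"
  shows "gauss n p = density (leb n)
    (\<lambda>x. ennreal (1 / (2 * p powr (1 / p) * Gamma (1 + 1 / p)) ^ n) * ennreal (exp (- (psum n p x / p))))"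
proof -
  define Z where "Z = 2 * p powr (1 / p) * Gamma (1 + 1 / p)"
  have Z: "Z > 0" using gen_gaussian_const_pos[OF assms] by (simp add: Z_def)
  interpret prob_space "gen_gaussian p" by (rule prob_space_gen_gaussian) fact
  have "sigma_finite_measure (gen_gaussian p)" ..
  then have "gauss n p = density (leb n) (\<lambda>x. \<Prod>i<n. ennreal (exp (- (\<bar>x i\<bar> powr p / p)) / Z))"
    unfolding gen_gaussian_def Z_def
    by (intro PiM_density) (auto intro: lborel.sigma_finite_measure_axioms)
  also have "(\<lambda>x. \<Prod>i<n. ennreal (exp (- (\<bar>x i\<bar> powr p / p)) / Z))
    = (\<lambda>x. ennreal (1 / Z ^ n) * ennreal (exp (- (psum n p x / p))))"
  proof
    fix x :: "nat \<Rightarrow> real"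
    have "(\<Prod>i<n. ennreal (exp (- (\<bar>x i\<bar> powr p / p)) / Z)) = ennreal (\<Prod>i<n. exp (- (\<bar>x i\<bar> powr p / p)) / Z)"
      using Z by (intro prod_ennreal) auto
    also have "(\<Prod>i<n. exp (- (\<bar>x i\<bar> powr p / p)) / Z) = 1 / Z ^ n * exp (- (psum n p x / p))"
      by (simp add: prod_dividef psum_def sum_negf sum_divide_distrib flip: exp_sum)
    finally show "(\<Prod>i<n. ennreal (exp (- (\<bar>x i\<bar> powr p / p)) / Z))
      = ennreal (1 / Z ^ n) * ennreal (exp (- (psum n p x / p)))"
      using Z by (simp only: ennreal_mult[of "1 / Z ^ n"]) (subst ennreal_mult, auto)
  qed
  finally show ?thesis by (simp add: Z_def)
qed

text \<open>Restricting the scaled vector to \<open>{..<n}\<close> keeps it extensional, hence in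
  the space. Measurability is included because cones enter only as events.\<close>

definition cone :: "nat \<Rightarrow> (nat \<Rightarrow> real) set \<Rightarrow> bool" where
  "cone n C \<longleftrightarrow> C \<in> sets (leb n) \<and> (\<forall>x\<in>space (leb n). \<forall>r>0. (\<lambda>i\<in>{..<n}. r * x i) \<in> C \<longleftrightarrow> x \<in> C)"

lemma cone_space: "cone n (space (leb n))"
  by (auto simp: cone_def space_PiM)

lemma cone_sets[measurable_dest]: "cone n C \<Longrightarrow> C \<in> sets (leb n)"
  by (simp add: cone_def)

text \<open>Dilation by \<open>u powr (1 / p)\<close> carries the part of \<open>C\<close> with
  \<open>psum n p x \<le> 1\<close> onto the part with \<open>psum n p x \<le> u\<close> and
  multiplies volumes by its n-th power.\<close>

lemma emeasure_cone_psum_le: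
  assumes p: "p > 0" and u: "u > 0" and C: "cone n C"
  shows "emeasure (leb n) (C \<inter> {x. psum n p x \<le> u})
    = ennreal (u powr (n / p)) * emeasure (leb n) (C \<inter> {x. psum n p x \<le> 1})"
proof -
  note [measurable] = cone_sets[OF C]
  define r where "r = u powr (1 / p)"
  have r: "r > 0" "r powr p = u" using u p by (auto simp: r_def powr_powr)
  have sub: "C \<subseteq> space (leb n)" using sets.sets_into_space[OF cone_sets[OF C]] .
  have "C \<inter> {x. psum n p x \<le> u} = {x \<in> space (leb n). x \<in> C \<and> psum n p x \<le> u}" using sub by auto
  then have "C \<inter> {x. psum n p x \<le> u} \<in> sets (leb n)" by simp
  then have "emeasure (leb n) (C \<inter> {x. psum n p x \<le> u}) = ennreal r ^ n *
    emeasure (leb n) {x \<in> space (leb n). (\<lambda>i\<in>{..<n}. r * x i) \<in> C \<inter> {x. psum n p x \<le> u}}"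
    using r by (subst emeasure_PiM_lborel_scale[of "{..<n}" r]) auto
  also have "{x \<in> space (leb n). (\<lambda>i\<in>{..<n}. r * x i) \<in> C \<inter> {x. psum n p x \<le> u}} = C \<inter> {x. psum n p x \<le> 1}"
    using C r u sub by (auto simp: cone_def psum_scale)
  also have "ennreal r ^ n = ennreal (u powr (n / p))"
    using r u by (simp add: r_def ennreal_power powr_powr flip: powr_realpow)
  finally show ?thesis .
qed

text \<open>With \<open>exp (- a)\<close> written as the integral of \<open>exp (- u)\<close> over \<open>u \<ge> a\<close>, Fubini leaves the volumes of the
  sets \<open>C \<inter> {x. psum n p x \<le> p u}\<close>, which by homogeneity are multiples of the one for \<open>p u = 1\<close>.\<close>
lemma emeasure_gauss_cone:
  assumes p: "p > 0"
  obtains K where "\<And>C. cone n C \<Longrightarrow> emeasure (gauss n p) C = K * emeasure (leb n) (C \<inter> {x. psum n p x \<le> 1})"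
proof
  let ?Z = "ennreal (1 / (2 * p powr (1 / p) * Gamma (1 + 1 / p)) ^ n)"
  fix C assume C: "cone n C"
  note [measurable] = cone_sets[OF C]
  have sub: "C \<subseteq> space (leb n)" using sets.sets_into_space[OF cone_sets[OF C]] .
  interpret product_sigma_finite "\<lambda>_::nat. lborel :: real measure" ..
  interpret finite_product_sigma_finite "\<lambda>_::nat. lborel :: real measure" "{..<n}" by standard auto
  interpret pair_sigma_finite "leb n" "lborel :: real measure" ..
  let ?f = "\<lambda>x u. indicator C x * (ennreal (exp (- u)) * indicator {psum n p x / p..} u)"
  have "emeasure (gauss n p) C = (\<integral>\<^sup>+x. ?Z * (indicator C x * ennreal (exp (- (psum n p x / p)))) \<partial>leb n)"
    unfolding gauss_eq_density[OF p]
    by (subst emeasure_density) (auto simp: mult_ac intro!: nn_integral_cong)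
  also have "\<dots> = ?Z * (\<integral>\<^sup>+x. \<integral>\<^sup>+u. ?f x u \<partial>lborel \<partial>leb n)"
    by (simp add: nn_integral_cmult nn_integral_exp_atLeast)
  also have "(\<integral>\<^sup>+x. \<integral>\<^sup>+u. ?f x u \<partial>lborel \<partial>leb n) = (\<integral>\<^sup>+u. \<integral>\<^sup>+x. ?f x u \<partial>leb n \<partial>lborel)"
  proof (rule Fubini'[symmetric])
    have "case_prod ?f = (\<lambda>(x, u). indicator C x * (ennreal (exp (- u)) *
       (if psum n p x / p \<le> u then 1 else 0)))"
      by (auto simp: fun_eq_iff)
    then show "case_prod ?f \<in> borel_measurable (leb n \<Otimes>\<^sub>M lborel)" by simp
  qed
  also have "\<dots> = (\<integral>\<^sup>+u. (ennreal (exp (- u)) * ennreal ((p * u) powr (n / p)) * indicator {0<..} u) *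
      emeasure (leb n) (C \<inter> {x. psum n p x \<le> 1}) \<partial>lborel)"
  proof (rule nn_integral_cong_AE)
    \<comment> \<open>The homogeneity lemma requires u > 0, so the null set {0} is
      discarded.\<close>
    have "AE u in lborel. u \<noteq> (0 :: real)" by (rule AE_lborel_singleton)
    then show "AE u in lborel. (\<integral>\<^sup>+x. ?f x u \<partial>leb n) = (ennreal (exp (- u)) * ennreal ((p * u) powr (n / p)) * indicator {0<..} u) *
      emeasure (leb n) (C \<inter> {x. psum n p x \<le> 1})"
    proof eventually_elim
      case (elim u)
      show ?case
      proof (cases "u > 0")
        case False
        have "?f x u = 0" for x
        proof -
          have "psum n p x / p \<ge> 0" using p by simp
          then have "\<not> psum n p x / p \<le> u" using False elim by linarith
          then show ?thesis by simp
        qed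
        then have "(\<integral>\<^sup>+x. ?f x u \<partial>leb n) = 0" by (simp only: nn_integral_const) simp
        then show ?thesis using False by simp
      next
        case True
        have "(\<integral>\<^sup>+x. ?f x u \<partial>leb n) = (\<integral>\<^sup>+x. ennreal (exp (- u)) * indicator (C \<inter> {x. psum n p x \<le> p * u}) x \<partial>leb n)"
          using p by (intro nn_integral_cong) (auto simp: indicator_def field_simps)
        also have "\<dots> = ennreal (exp (- u)) * emeasure (leb n) (C \<inter> {x. psum n p x \<le> p * u})"
        proof -
          have "C \<inter> {x. psum n p x \<le> p * u} = {x \<in> space (leb n). x \<in> C \<and> psum n p x \<le> p * u}" using sub by auto
          then have "C \<inter> {x. psum n p x \<le> p * u} \<in> sets (leb n)" by simp
          then show ?thesis by (simp add: nn_integral_cmult_indicator)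
        qed
        finally show ?thesis using True p by (simp add: emeasure_cone_psum_le[OF p _ C, of "p * u"] mult.assoc)
      qed
    qed
  qed
  also have "\<dots> = (\<integral>\<^sup>+u. ennreal (exp (- u)) * ennreal ((p * u) powr (n / p)) * indicator {0<..} u \<partial>lborel) *
      emeasure (leb n) (C \<inter> {x. psum n p x \<le> 1})"
    by (rule nn_integral_multc) measurable
  \<comment> \<open>This fact instantiates \<open>K\<close>. What matters is that its first factor
    does not involve \<open>C\<close>.\<close>
  finally show "emeasure (gauss n p) C = (?Z * (\<integral>\<^sup>+u. ennreal (exp (- u)) * ennreal ((p * u) powr (n / p)) * indicator {0<..} u \<partial>lborel))
    * emeasure (leb n) (C \<inter> {x. psum n p x \<le> 1})"
    by (simp add: mult.assoc)
qed

lemma prob_space_gauss: "p > 0 \<Longrightarrow> prob_space (gauss n p)"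
  by (intro prob_space_PiM prob_space_gen_gaussian)

lemma lp_ball_eq: "p > 0 \<Longrightarrow> lp_ball n p = {x \<in> space (leb n). psum n p x \<le> 1}"
proof -
  assume p: "p > 0"
  have "a powr (1 / p) \<le> 1 \<longleftrightarrow> a \<le> 1" if "a \<ge> 0" for a :: real
    using p that powr_less_mono2[of "1 / p" 1 a] powr_mono2[of "1 / p" a 1] by (auto simp: not_le[symmetric] simp del: not_le)
  then show ?thesis by (auto simp: lp_ball_def lp_norm_def simp flip: psum_def)
qed

text \<open>Taking the whole space as the cone gives \<open>K * vol = 1\<close> for the volume of
  the ball. So the volume is neither 0 nor infinite without being computed, and \<open>K\<close> is
  precisely the normalisation of the uniform distribution.\<close>

lemma emeasure_lp_ball:
  assumes p: "p > 0"
  shows "emeasure (leb n) (lp_ball n p) \<noteq> 0" "emeasure (leb n) (lp_ball n p) \<noteq> \<infinity>"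
    and unif_cone: "cone n C \<Longrightarrow> measure (unif_lp_ball n p) C = measure (gauss n p) C"
proof -
  interpret prob_space "gauss n p" using p by (rule prob_space_gauss)
  obtain K where K: "\<And>C. cone n C \<Longrightarrow> emeasure (gauss n p) C = K * emeasure (leb n) (C \<inter> {x. psum n p x \<le> 1})"
    using emeasure_gauss_cone[OF p] by blast
  let ?B = "lp_ball n p"
  have B: "C \<inter> {x. psum n p x \<le> 1} = C \<inter> ?B" if "C \<subseteq> space (leb n)" for C
    using that by (auto simp: lp_ball_eq[OF p])
  have KB: "K * emeasure (leb n) ?B = 1"
    using K[OF cone_space] B[of "space (leb n)"] emeasure_space_1
    by (simp add: psum_cong_PiM) (auto simp: lp_ball_def Collect_conj_eq Int_absorb1)
  then show 0: "emeasure (leb n) ?B \<noteq> 0" by auto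
  have K0: "K \<noteq> 0" using KB by auto
  show fin: "emeasure (leb n) ?B \<noteq> \<infinity>" using KB K0 by (auto simp: ennreal_mult_top)
  have meas_B: "?B \<in> sets (leb n)" unfolding lp_ball_eq[OF p] by measurable
  assume C: "cone n C"
  have "emeasure (unif_lp_ball n p) C = emeasure (leb n) (?B \<inter> C) / emeasure (leb n) ?B"
    unfolding unif_lp_ball_def using C meas_B by (intro emeasure_uniform_measure) (auto simp: cone_def)
  also have "emeasure (leb n) (?B \<inter> C) = (K * emeasure (leb n) (C \<inter> ?B)) * emeasure (leb n) ?B"
  proof -
    have "emeasure (leb n) (?B \<inter> C) = (K * emeasure (leb n) ?B) * emeasure (leb n) (C \<inter> ?B)"
      unfolding KB by (simp add: Int_commute)
    then show ?thesis by (simp only: mult_ac)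
  qed
  also have "\<dots> / emeasure (leb n) ?B = K * emeasure (leb n) (C \<inter> ?B)"
    using 0 fin by (simp add: mult_divide_eq_ennreal)
  also have "\<dots> = emeasure (gauss n p) C"
    using K[OF C] B[OF sets.sets_into_space[OF cone_sets[OF C]]] by simp
  finally show "measure (unif_lp_ball n p) C = measure (gauss n p) C" by (simp add: measure_def)
qed

lemma sets_unif[simp, measurable_cong]: "sets (unif_lp_ball n p) = sets (leb n)"
  and space_unif[simp]: "space (unif_lp_ball n p) = space (leb n)"
  by (simp_all add: unif_lp_ball_def)

lemma prob_space_unif: "p > 0 \<Longrightarrow> prob_space (unif_lp_ball n p)"
  unfolding unif_lp_ball_def by (intro prob_space_uniform_measure emeasure_lp_ball)

text \<open>Independence of radius and direction under the uniform distribution: the factor for the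
  radius is the same for every cone.\<close>

lemma unif_cone_psum_le:
  assumes p: "p > 0" and u: "0 < u" "u \<le> 1" and C: "cone n C"
  shows "measure (unif_lp_ball n p) (C \<inter> {x. psum n p x \<le> u}) = u powr (n / p) * measure (gauss n p) C"
proof -
  let ?B = "lp_ball n p"
  have sub: "C \<subseteq> space (leb n)" using sets.sets_into_space[OF cone_sets[OF C]] .
  note [measurable] = cone_sets[OF C]
  have meas_B: "?B \<in> sets (leb n)" unfolding lp_ball_eq[OF p] by measurable
  have eq: "C \<inter> {x. psum n p x \<le> u} = {x \<in> space (leb n). x \<in> C \<and> psum n p x \<le> u}" for u using sub by auto
  have m: "C \<inter> {x. psum n p x \<le> u} \<in> sets (leb n)" for u unfolding eq by measurable
  have "measure (unif_lp_ball n p) (C \<inter> {x. psum n p x \<le> u}) = measure (leb n) (C \<inter> {x. psum n p x \<le> u}) / measure (leb n) ?B"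
  proof -
    have "?B \<inter> (C \<inter> {x. psum n p x \<le> u}) = C \<inter> {x. psum n p x \<le> u}"
      using u sub by (auto simp: lp_ball_eq[OF p])
    then show ?thesis unfolding unif_lp_ball_def
      using emeasure_lp_ball[OF p, of n] m by (subst measure_uniform_measure) auto
  qed
  also have "measure (leb n) (C \<inter> {x. psum n p x \<le> u}) = u powr (n / p) * measure (leb n) (C \<inter> {x. psum n p x \<le> 1})"
    using u by (simp add: measure_def emeasure_cone_psum_le[OF p _ C, of u] enn2real_mult)
  also have "\<dots> / measure (leb n) ?B = u powr (n / p) * measure (unif_lp_ball n p) C"
  proof -
    have "C \<inter> {x. psum n p x \<le> 1} = ?B \<inter> C" using sub by (auto simp: lp_ball_eq[OF p])
    then show ?thesis unfolding unif_lp_ball_def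
      using emeasure_lp_ball[OF p, of n] cone_sets[OF C] by (subst measure_uniform_measure) auto
  qed
  finally show ?thesis using unif_cone[OF p C] by simp
qed

section \<open>Tails of sums of powers of generalized Gaussians\<close>

text \<open>Multiply by 1 - x > 0: the right side becomes 1 - x^3 \<ge> 1, the left side (1 - x) exp
  x \<le> 1. The bound needs second moments only, which suits lower tails.\<close>

lemma exp_le_quadratic_nonpos: "exp x \<le> 1 + x + x\<^sup>2" if "x \<le> 0" for x :: real
proof -
  have "(1 + (-x)) * (1 + x + x\<^sup>2) = 1 - x ^ 3"
    by (simp add: algebra_simps power2_eq_square power3_eq_cube)
  moreover have "x ^ 3 \<le> 0" using that power_le_zero_eq[of x 3] by simp
  moreover have "exp x * (1 + (-x)) \<le> exp x * exp (-x)"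
    using exp_ge_add_one_self[of "-x"] by (intro mult_left_mono) auto
  moreover have "exp x * exp (- x) = 1" by (simp flip: exp_add)
  ultimately have "(1 + (-x)) * exp x \<le> (1 + (-x)) * (1 + x + x\<^sup>2)"
    unfolding power3_eq_cube mult.commute[of "1 + (-x)" "exp x"] by linarith
  then show ?thesis using that by (subst (asm) mult_le_cancel_left_pos) auto
qed

text \<open>The inequality exp x \<le> 1 + x exp x, inserted into itself. The remainder keeps its
  exponential factor, to be dominated by an integrable one.\<close>

lemma exp_le_quadratic_nonneg: "exp x \<le> 1 + x + x\<^sup>2 * exp x" if "x \<ge> 0" for x :: real
proof -
  have "exp x * (1 + (-x)) \<le> exp x * exp (-x)"
    using exp_ge_add_one_self[of "-x"] by (intro mult_left_mono) auto
  then have *: "exp x \<le> 1 + x * exp x" by (simp add: algebra_simps flip: exp_add)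
  also have "x * exp x \<le> x * (1 + x * exp x)" using * that by (rule mult_left_mono)
  finally show ?thesis by (simp add: algebra_simps power2_eq_square)
qed

text \<open>Markov's inequality for a product of functions of independent coordinates.
  \<open>f\<close> depends on the index so that a single coordinate can be treated
  separately.\<close>

lemma measure_gauss_le_prod:
  assumes p: "p > 0" and K: "K \<ge> 0"
    and f: "\<And>i. i < n \<Longrightarrow> integrable (gen_gaussian p) (f i)" "\<And>i y. i < n \<Longrightarrow> 0 \<le> f i y"
    and A: "A \<in> sets (leb n)" "\<And>x. x \<in> A \<Longrightarrow> 1 \<le> K * (\<Prod>i<n. f i (x i))"
  shows "measure (gauss n p) A \<le> K * (\<Prod>i<n. \<integral>y. f i y \<partial>gen_gaussian p)"
proof -
  interpret G: prob_space "gen_gaussian p" by (rule prob_space_gen_gaussian) fact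
  interpret product_sigma_finite "\<lambda>_::nat. gen_gaussian p"
    by (rule product_sigma_finite.intro) (rule G.sigma_finite_measure_axioms)
  interpret prob_space "gauss n p" by (rule prob_space_gauss) fact
  have A': "A \<in> sets (gauss n p)" using A by (simp only: psum_cong_PiM)
  have int: "integrable (gauss n p) (\<lambda>x. \<Prod>i<n. f i (x i))"
    using f by (intro product_integrable_prod) auto
  have "measure (gauss n p) A = (\<integral>x. indicator A x \<partial>gauss n p)" using A' by simp
  also have "\<dots> \<le> (\<integral>x. K * (\<Prod>i<n. f i (x i)) \<partial>gauss n p)"
  proof (rule integral_mono)
    show "integrable (gauss n p) (indicator A :: _ \<Rightarrow> real)"
      using A' by (intro integrable_real_indicator) (auto simp: less_top[symmetric])
    show "integrable (gauss n p) (\<lambda>x. K * (\<Prod>i<n. f i (x i)))" using int by simp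
    show "indicator A x \<le> K * (\<Prod>i<n. f i (x i))" for x
      using A(2)[of x] K f(2) by (auto simp: indicator_def intro!: mult_nonneg_nonneg prod_nonneg)
  qed
  also have "\<dots> = K * (\<integral>x. (\<Prod>i<n. f i (x i)) \<partial>gauss n p)" by simp
  also have "(\<integral>x. (\<Prod>i<n. f i (x i)) \<partial>gauss n p) = (\<Prod>i<n. \<integral>y. f i y \<partial>gen_gaussian p)"
    using f by (intro product_integral_prod) auto
  finally show ?thesis .
qed

text \<open>A second-order expression replaces the exponential moment, and 1 + m \<le> exp m
  finishes the bound. The exponential has to be dominated only on \<open>E\<close>, which admits
  truncation; off \<open>E\<close> nonnegativity of the expression is enough. The sign of
  \<open>l\<close> selects the tail.\<close>

lemma gauss_chernoff:
  fixes Y W :: "real \<Rightarrow> real"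
  assumes p: "p > 0" and Y: "integrable (gen_gaussian p) Y" and W: "integrable (gen_gaussian p) W"
    and le: "\<And>y. exp (l * Y y) * indicator E y \<le> 1 + l * Y y + l\<^sup>2 * W y"
    and A: "A \<in> sets (leb n)" "\<And>x i. x \<in> A \<Longrightarrow> i < n \<Longrightarrow> x i \<in> E"
      "\<And>x. x \<in> A \<Longrightarrow> l * c \<le> l * (\<Sum>i<n. Y (x i))"
  shows "measure (gauss n p) A
    \<le> exp (real n * (l * (\<integral>y. Y y \<partial>gen_gaussian p) + l\<^sup>2 * (\<integral>y. W y \<partial>gen_gaussian p)) - l * c)"
proof -
  interpret G: prob_space "gen_gaussian p" by (rule prob_space_gen_gaussian) fact
  let ?g = "\<lambda>y. 1 + l * Y y + l\<^sup>2 * W y"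
  let ?m = "l * (\<integral>y. Y y \<partial>gen_gaussian p) + l\<^sup>2 * (\<integral>y. W y \<partial>gen_gaussian p)"
  have g: "integrable (gen_gaussian p) ?g" using Y W by simp
  have g0: "0 \<le> ?g y" for y using le[of y] by (auto intro: order_trans[rotated])
  have "measure (gauss n p) A \<le> exp (- (l * c)) * (\<Prod>i<n. \<integral>y. ?g y \<partial>gen_gaussian p)"
  proof (rule measure_gauss_le_prod[OF p _ g g0 A(1)])
    fix x assume x: "x \<in> A"
    have "1 \<le> exp (- (l * c)) * exp (l * (\<Sum>i<n. Y (x i)))"
      using A(3)[OF x] by (simp flip: exp_add)
    also have "exp (l * (\<Sum>i<n. Y (x i))) = (\<Prod>i<n. exp (l * Y (x i)))"
      by (simp add: exp_sum sum_distrib_left)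
    also have "\<dots> \<le> (\<Prod>i<n. ?g (x i))"
    proof (intro prod_mono conjI)
      fix i assume "i \<in> {..<n}"
      then show "exp (l * Y (x i)) \<le> ?g (x i)" using le[of "x i"] A(2)[OF x] by simp
    qed simp
    finally show "1 \<le> exp (- (l * c)) * (\<Prod>i<n. ?g (x i))" by simp
  qed auto
  also have "(\<integral>y. ?g y \<partial>gen_gaussian p) = 1 + ?m" using Y W by (simp add: G.prob_space[simplified])
  also have "exp (- (l * c)) * (\<Prod>i<n. 1 + ?m) \<le> exp (- (l * c)) * (\<Prod>i<n. exp ?m)"
  proof (intro mult_left_mono prod_mono conjI)
    have "(\<integral>y. ?g y \<partial>gen_gaussian p) \<ge> 0" using g0 by simp
    then show "0 \<le> 1 + ?m" using Y W by (simp add: G.prob_space[simplified])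
    show "1 + ?m \<le> exp ?m" by (rule exp_ge_add_one_self)
  qed auto
  also have "\<dots> = exp (real n * ?m - l * c)" by (simp add: exp_diff exp_minus field_simps flip: exp_of_nat_mult)
  finally show ?thesis .
qed

lemma powr_square: "(x powr s)\<^sup>2 = x powr (2 * s)" for x s :: real
  by (simp add: power2_eq_square flip: powr_add)

lemma psum_set[measurable]:
  "{x \<in> space (leb n). psum n s x \<le> c} \<in> sets (leb n)" "{x \<in> space (leb n). c \<le> psum n s x} \<in> sets (leb n)"
  by measurable

text \<open>The summands are nonnegative, so a negative Chernoff parameter needs no exponential
  moments and every exponent s is allowed, also s > p.\<close>

lemma gauss_psum_lower_tail:
  assumes p: "p > 0" and s: "s \<ge> 0" and a: "a < M_p p s"
  shows "\<exists>c>0. \<forall>n. measure (gauss n p) {x \<in> space (leb n). psum n s x \<le> real n * a} \<le> exp (- (c * real n))"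
proof -
  define V where "V = (\<integral>y. \<bar>y\<bar> powr (2 * s) \<partial>gen_gaussian p)"
  \<comment> \<open>Chosen so that the quadratic term \<open>t * V\<close> uses up at most half of
    the gap; V + 1 avoids division by 0.\<close>
  define t where "t = (M_p p s - a) / (2 * (V + 1))"
  have V: "V \<ge> 0" by (simp add: V_def)
  have t: "t > 0" using V a by (simp add: t_def)
  have tV: "t * V \<le> (M_p p s - a) / 2"
  proof -
    have "t * V \<le> t * (V + 1)" using t by simp
    also have "\<dots> = (M_p p s - a) / 2" using V by (simp add: t_def divide_simps)
    finally show ?thesis .
  qed
  have "measure (gauss n p) {x \<in> space (leb n). psum n s x \<le> real n * a} \<le> exp (- (t * ((M_p p s - a) / 2) * real n))" for n
  proof -
    have "measure (gauss n p) {x \<in> space (leb n). psum n s x \<le> real n * a}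
      \<le> exp (real n * ((- t) * (\<integral>y. \<bar>y\<bar> powr s \<partial>gen_gaussian p) + (- t)\<^sup>2 * V) - (- t) * (real n * a))"
      unfolding V_def
    proof (rule gauss_chernoff[where E = UNIV])
      fix y :: real
      show "exp (- t * \<bar>y\<bar> powr s) * indicator UNIV y \<le> 1 + - t * \<bar>y\<bar> powr s + (- t)\<^sup>2 * \<bar>y\<bar> powr (2 * s)"
        using exp_le_quadratic_nonpos[of "- t * \<bar>y\<bar> powr s"] t
        by (simp add: power_mult_distrib powr_square)
    qed (use t s p in \<open>auto simp: psum_def integrable_gen_gaussian_powr\<close>)
    also have "\<dots> = exp (- (real n * t * (M_p p s - a - t * V)))"
      using p s by (simp add: integral_gen_gaussian_powr algebra_simps power2_eq_square)
    also have "\<dots> \<le> exp (- (real n * t * ((M_p p s - a) / 2)))"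
    proof -
      have "(M_p p s - a) / 2 \<le> M_p p s - a - t * V" using tV by (simp add: field_simps)
      then have "real n * t * ((M_p p s - a) / 2) \<le> real n * t * (M_p p s - a - t * V)"
        using t by (intro mult_left_mono) auto
      then show ?thesis by simp
    qed
    finally show ?thesis by (simp add: mult_ac)
  qed
  moreover have "t * ((M_p p s - a) / 2) > 0" using t a by simp
  ultimately show ?thesis by blast
qed

text \<open>Only the exponent p itself is treated: its exponential moments are finite for parameters
  below 1 / p, and the mean is 1 by \<open>M_p_self\<close>.\<close>

lemma gauss_psum_upper_tail:
  assumes p: "p > 0" and a: "a > 1"
  shows "\<exists>c>0. \<forall>n. measure (gauss n p) {x \<in> space (leb n). real n * a \<le> psum n p x} \<le> exp (- (c * real n))"
proof -
  define V where "V = (\<integral>y. \<bar>y\<bar> powr (2 * p) * exp (1 / (2 * p) * \<bar>y\<bar> powr p) \<partial>gen_gaussian p)"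
  \<comment> \<open>The cap 1 / (2 p) dominates the remainder by one fixed integrable function; the
    second bound halves the gap as for the lower tail.\<close>
  define t where "t = min (1 / (2 * p)) ((a - 1) / (2 * (V + 1)))"
  have V: "V \<ge> 0" by (simp add: V_def)
  have t: "t > 0" "t \<le> 1 / (2 * p)" "t \<le> (a - 1) / (2 * (V + 1))" using V a p by (simp_all add: t_def)
  have tV: "t * V \<le> (a - 1) / 2"
  proof -
    have "t * V \<le> (a - 1) / (2 * (V + 1)) * (V + 1)" using t V by (intro mult_mono) auto
    also have "\<dots> = (a - 1) / 2" using V by (simp add: divide_simps)
    finally show ?thesis .
  qed
  have "measure (gauss n p) {x \<in> space (leb n). real n * a \<le> psum n p x} \<le> exp (- (t * ((a - 1) / 2) * real n))" for n
  proof -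
    have "measure (gauss n p) {x \<in> space (leb n). real n * a \<le> psum n p x}
      \<le> exp (real n * (t * (\<integral>y. \<bar>y\<bar> powr p \<partial>gen_gaussian p) + t\<^sup>2 * V) - t * (real n * a))"
      unfolding V_def
    proof (rule gauss_chernoff[where E = UNIV])
      fix y :: real
      have "exp (t * \<bar>y\<bar> powr p) \<le> 1 + t * \<bar>y\<bar> powr p + (t * \<bar>y\<bar> powr p)\<^sup>2 * exp (t * \<bar>y\<bar> powr p)"
        using t by (intro exp_le_quadratic_nonneg) auto
      also have "(t * \<bar>y\<bar> powr p)\<^sup>2 * exp (t * \<bar>y\<bar> powr p) \<le> (t * \<bar>y\<bar> powr p)\<^sup>2 * exp (1 / (2 * p) * \<bar>y\<bar> powr p)"
        using mult_right_mono[OF t(2), of "\<bar>y\<bar> powr p"] by (intro mult_left_mono) auto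
      also have "(t * \<bar>y\<bar> powr p)\<^sup>2 = t\<^sup>2 * \<bar>y\<bar> powr (2 * p)"
        by (simp add: power_mult_distrib power2_eq_square flip: powr_add)
      finally show "exp (t * \<bar>y\<bar> powr p) * indicator UNIV y
          \<le> 1 + t * \<bar>y\<bar> powr p + t\<^sup>2 * (\<bar>y\<bar> powr (2 * p) * exp (1 / (2 * p) * \<bar>y\<bar> powr p))"
        by (simp add: mult.assoc)
    next
      show "integrable (gen_gaussian p) (\<lambda>y. \<bar>y\<bar> powr (2 * p) * exp (1 / (2 * p) * \<bar>y\<bar> powr p))"
        using p by (intro integrable_gen_gaussian) auto
    qed (use t p in \<open>auto simp: psum_def integrable_gen_gaussian_powr\<close>)
    also have "\<dots> = exp (- (real n * t * (a - 1 - t * V)))"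
      using p by (simp add: integral_gen_gaussian_powr M_p_self algebra_simps power2_eq_square)
    also have "\<dots> \<le> exp (- (real n * t * ((a - 1) / 2)))"
    proof -
      have "(a - 1) / 2 \<le> a - 1 - t * V" using tV by (simp add: field_simps)
      then have "real n * t * ((a - 1) / 2) \<le> real n * t * (a - 1 - t * V)"
        using t by (intro mult_left_mono) auto
      then show ?thesis by simp
    qed
    finally show ?thesis by (simp add: mult_ac)
  qed
  moreover have "t * ((a - 1) / 2) > 0" using t a by simp
  ultimately show ?thesis by blast
qed

section \<open>Sums of q-th powers for q > p\<close>

text \<open>Either one coordinate satisfies \<open>\<bar>y i\<bar> powr q > L\<close> with \<open>L = n (x - M)\<close>, or the Chernoff bound applies
  to the truncated sum with parameter \<open>l = \<theta> L powr (p / q - 1) / p\<close>: below the truncation level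
  \<open>l \<bar>y\<bar> powr q \<le> \<theta> \<bar>y\<bar> powr p / p\<close>, so the truncated exponential moments stay bounded for \<open>\<theta> < 1\<close>.\<close>
lemma gauss_psum_heavy_upper:
  assumes p: "p > 0" and pq: "p < q" and x: "M_p p q < x" and J: "J < (x - M_p p q) powr (p / q) / p"
  shows "\<forall>\<^sub>F n in sequentially.
    measure (gauss n p) {y \<in> space (leb n). real n * x \<le> psum n q y} \<le> exp (- (J * real n powr (p / q)))"
proof -
  define r where "r = p / q"
  define D where "D = x - M_p p q"
  have q: "q > 0" and r: "0 < r" "r < 1" and D: "D > 0"
    using p pq x by (auto simp: r_def D_def)
  \<comment> \<open>\<theta> < 1 keeps the tilted moments \<open>V\<close> and \<open>W\<close>
    finite, and it is close enough to 1 for the rate to stay above \<open>J\<close>.\<close>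
  obtain \<theta> where \<theta>: "0 < \<theta>" "\<theta> < 1" "J < \<theta> * (D powr r / p)"
  proof -
    define B where "B = D powr r / p"
    have B: "B > 0" "J < B" using D p J by (auto simp: B_def D_def r_def)
    then have "max 0 (J / B) < 1" by simp
    then obtain \<theta> where "max 0 (J / B) < \<theta>" "\<theta> < 1" using dense by blast
    then have "0 < \<theta>" "\<theta> < 1" "J < \<theta> * B" using B by (auto simp: field_simps)
    then show ?thesis using that by (simp add: B_def)
  qed
  define J1 where "J1 = \<theta> * (D powr r / p)"
  \<comment> \<open>The gap from \<open>J1\<close> to \<open>K\<close> absorbs the factor n of the
    union bound and the quadratic Chernoff term, the gap from \<open>K\<close> to \<open>J\<close>
    the sum of the two contributions.\<close>
  define K where "K = (J + J1) / 2"
  have "J < J1" using \<theta>(3) by (simp only: J1_def)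
  then have K: "J < K" "K < J1" by (simp_all add: K_def)
  have \<theta>p: "p * (\<theta> / p) < 1" using \<theta> p by simp
  define V where "V = (\<integral>y. \<bar>y\<bar> powr (2 * q) * exp (\<theta> / p * \<bar>y\<bar> powr p) \<partial>gen_gaussian p)"
  define W where "W = (\<integral>y. exp (\<theta> / p * \<bar>y\<bar> powr p) \<partial>gen_gaussian p)"
  interpret G: prob_space "gen_gaussian p" by (rule prob_space_gen_gaussian) fact
  have int_exp: "integrable (gen_gaussian p) (\<lambda>y. exp (\<theta> / p * \<bar>y\<bar> powr p))"
  proof -
    \<comment> \<open>The indicator repairs the value at 0, where \<open>|y| powr 0\<close>
      vanishes.\<close>
    have "integrable (gen_gaussian p) (\<lambda>y. \<bar>y\<bar> powr 0 * exp (\<theta> / p * \<bar>y\<bar> powr p) + indicator {0} y)"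
      using p \<theta>p by (intro Bochner_Integration.integrable_add integrable_gen_gaussian integrable_real_indicator)
        (auto simp: less_top[symmetric])
    also have "(\<lambda>y. \<bar>y\<bar> powr 0 * exp (\<theta> / p * \<bar>y\<bar> powr p) + indicator {0} y) = (\<lambda>y. exp (\<theta> / p * \<bar>y\<bar> powr p))"
      using p by (auto simp: fun_eq_iff)
    finally show ?thesis .
  qed
  \<comment> \<open>Coefficient of the quadratic term n l^2 V. Since l is of order n^(r - 1), this
    term has order n^(2 r - 1), below n^r because r < 1.\<close>
  define C where "C = V * \<theta>\<^sup>2 * D powr (2 * r - 2) / p\<^sup>2"
  have main: "measure (gauss n p) {y \<in> space (leb n). real n * x \<le> psum n q y}
    \<le> real n * (exp (- (J1 * real n powr r)) * W) + exp (C * real n powr (2 * r - 1) - J1 * real n powr r)"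
    if n: "n > 0" for n
  proof -
    define L where "L = real n * D"
    define l where "l = \<theta> * L powr (r - 1) / p"
    have L: "L > 0" using n D by (simp add: L_def)
    have l: "l > 0" using \<theta> L p by (simp add: l_def)
    have lL: "l * L = J1 * real n powr r"
    proof -
      have "l * L = \<theta> * (L powr (r - 1) * L powr 1) / p" using L by (simp add: l_def)
      also have "L powr (r - 1) * L powr 1 = L powr r" using powr_add[of L "r - 1" 1] by simp
      finally show ?thesis using n D by (simp add: J1_def L_def powr_mult mult_ac)
    qed
    let ?S = "{y \<in> space (leb n). real n * x \<le> psum n q y}"
    let ?B = "\<lambda>i. {y \<in> space (leb n). L < \<bar>y i\<bar> powr q}"
    let ?A = "{y \<in> space (leb n). real n * x \<le> psum n q y \<and> (\<forall>i<n. \<bar>y i\<bar> powr q \<le> L)}"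
    have meas_A: "?A \<in> sets (leb n)"
    proof -
      have "?A = ?S \<inter> (\<Inter>i\<in>{..<n}. {y \<in> space (leb n). \<bar>y i\<bar> powr q \<le> L})" using n by auto
      also have "\<dots> \<in> sets (leb n)" using n by (intro sets.Int sets.finite_INT psum_set) auto
      finally show ?thesis .
    qed
    have meas_B: "?B i \<in> sets (leb n)" if "i < n" for i
      using that by simp
    \<comment> \<open>The exponent r - 1 is negative, so replacing L by the smaller
      \<open>|y| powr q\<close> increases the first factor; q r = p does the rest.\<close>
    have conv: "L powr (r - 1) * \<bar>y\<bar> powr q \<le> \<bar>y\<bar> powr p" if "\<bar>y\<bar> powr q \<le> L" for y :: real
    proof (cases "y = 0")
      case False
      have "L powr (r - 1) \<le> (\<bar>y\<bar> powr q) powr (r - 1)"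
        using that r False by (intro powr_mono2') auto
      then have "L powr (r - 1) * \<bar>y\<bar> powr q \<le> (\<bar>y\<bar> powr q) powr (r - 1) * \<bar>y\<bar> powr q"
        by (rule mult_right_mono) simp
      also have "\<dots> = \<bar>y\<bar> powr p" using q by (simp add: powr_powr r_def algebra_simps flip: powr_add)
      finally show ?thesis .
    qed simp
    \<comment> \<open>Markov's inequality for coordinate j alone, with all other factors equal to
      1.\<close>
    have tail: "measure (gauss n p) (?B j) \<le> exp (- (J1 * real n powr r)) * W" if j: "j < n" for j
    proof -
      have "measure (gauss n p) (?B j) \<le> exp (- (J1 * real n powr r)) *
        (\<Prod>i<n. \<integral>y. (if i = j then exp (\<theta> / p * \<bar>y\<bar> powr p) else 1) \<partial>gen_gaussian p)"
      proof (rule measure_gauss_le_prod[OF p])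
        fix y assume y: "y \<in> ?B j"
        have "(\<Prod>i<n. (if i = j then exp (\<theta> / p * \<bar>y i\<bar> powr p) else 1)) = exp (\<theta> / p * \<bar>y j\<bar> powr p)"
          using j by (simp add: prod.delta)
        moreover have "J1 * real n powr r \<le> \<theta> / p * \<bar>y j\<bar> powr p"
        proof -
          have "L powr r \<le> (\<bar>y j\<bar> powr q) powr r" using y r L by (intro powr_mono2) auto
          also have "\<dots> = \<bar>y j\<bar> powr p" using q by (simp add: powr_powr r_def)
          finally have "\<theta> / p * L powr r \<le> \<theta> / p * \<bar>y j\<bar> powr p" using \<theta> p by (intro mult_left_mono) auto
          then show ?thesis using n D by (simp add: J1_def L_def powr_mult mult_ac)
        qed
        ultimately show "1 \<le> exp (- (J1 * real n powr r)) * (\<Prod>i<n. (if i = j then exp (\<theta> / p * \<bar>y i\<bar> powr p) else 1))"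
          by (simp flip: exp_add)
      next
        fix i
        show "integrable (gen_gaussian p) (\<lambda>y. if i = j then exp (\<theta> / p * \<bar>y\<bar> powr p) else 1)"
          using int_exp by (cases "i = j") simp_all
      qed (use meas_B j in auto)
      also have "(\<Prod>i<n. \<integral>y. (if i = j then exp (\<theta> / p * \<bar>y\<bar> powr p) else 1) \<partial>gen_gaussian p)
        = (\<Prod>i<n. if i = j then W else 1)"
        by (intro prod.cong) (auto simp: W_def G.prob_space[simplified])
      also have "\<dots> = W" using j by (simp add: prod.delta)
      finally show ?thesis .
    qed
    have "measure (gauss n p) ?A \<le> exp (real n * (l * (\<integral>y. \<bar>y\<bar> powr q \<partial>gen_gaussian p) + l\<^sup>2 * V) - l * (real n * x))"
      unfolding V_def
    proof (rule gauss_chernoff[where E = "{y. \<bar>y\<bar> powr q \<le> L}"])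
      fix y :: real
      show "exp (l * \<bar>y\<bar> powr q) * indicator {y. \<bar>y\<bar> powr q \<le> L} y
        \<le> 1 + l * \<bar>y\<bar> powr q + l\<^sup>2 * (\<bar>y\<bar> powr (2 * q) * exp (\<theta> / p * \<bar>y\<bar> powr p))"
      proof (cases "\<bar>y\<bar> powr q \<le> L")
        case True
        have "exp (l * \<bar>y\<bar> powr q) \<le> 1 + l * \<bar>y\<bar> powr q + (l * \<bar>y\<bar> powr q)\<^sup>2 * exp (l * \<bar>y\<bar> powr q)"
          using l by (intro exp_le_quadratic_nonneg) auto
        also have "(l * \<bar>y\<bar> powr q)\<^sup>2 * exp (l * \<bar>y\<bar> powr q) \<le> (l * \<bar>y\<bar> powr q)\<^sup>2 * exp (\<theta> / p * \<bar>y\<bar> powr p)"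
        proof -
          have "l * \<bar>y\<bar> powr q = \<theta> / p * (L powr (r - 1) * \<bar>y\<bar> powr q)" by (simp add: l_def)
          also have "\<dots> \<le> \<theta> / p * \<bar>y\<bar> powr p" using conv[OF True] \<theta> p by (intro mult_left_mono) auto
          finally show ?thesis by (intro mult_left_mono) auto
        qed
        finally show ?thesis using True by (simp add: power_mult_distrib powr_square mult.assoc)
      qed (use l in \<open>auto intro!: add_nonneg_nonneg\<close>)
    next
      show "integrable (gen_gaussian p) (\<lambda>y. \<bar>y\<bar> powr (2 * q) * exp (\<theta> / p * \<bar>y\<bar> powr p))"
        using p q \<theta>p by (intro integrable_gen_gaussian) auto
      show "?A \<in> sets (leb n)" by (rule meas_A)
    qed (use l p q in \<open>auto simp: psum_def integrable_gen_gaussian_powr\<close>)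
    also have "real n * (l * (\<integral>y. \<bar>y\<bar> powr q \<partial>gen_gaussian p) + l\<^sup>2 * V) - l * (real n * x) = real n * l\<^sup>2 * V - l * L"
      using p q by (simp add: integral_gen_gaussian_powr L_def D_def algebra_simps)
    also have "real n * l\<^sup>2 * V = C * real n powr (2 * r - 1)"
    proof -
      have "l\<^sup>2 = \<theta>\<^sup>2 * L powr (2 * r - 2) / p\<^sup>2"
        by (simp add: l_def power_mult_distrib power_divide powr_square algebra_simps)
      also have "L powr (2 * r - 2) = real n powr (2 * r - 2) * D powr (2 * r - 2)"
        using n D by (simp add: L_def powr_mult)
      finally have "real n * l\<^sup>2 * V = C * (real n powr 1 * real n powr (2 * r - 2))"
        by (simp add: C_def)
      also have "real n powr 1 * real n powr (2 * r - 2) = real n powr (2 * r - 1)"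
        using powr_add[of "real n" 1 "2 * r - 2"] by simp
      finally show ?thesis .
    qed
    finally have A_le: "measure (gauss n p) ?A \<le> exp (C * real n powr (2 * r - 1) - J1 * real n powr r)"
      by (simp only: lL)
    interpret prob_space "gauss n p" by (rule prob_space_gauss) fact
    have "?S \<subseteq> (\<Union>i\<in>{..<n}. ?B i) \<union> ?A" by (auto simp: not_less)
    then have "measure (gauss n p) ?S \<le> measure (gauss n p) ((\<Union>i\<in>{..<n}. ?B i) \<union> ?A)"
      using meas_A meas_B by (intro finite_measure_mono) (auto simp: psum_cong_PiM)
    also have "\<dots> \<le> measure (gauss n p) (\<Union>i\<in>{..<n}. ?B i) + measure (gauss n p) ?A"
      using meas_A meas_B by (intro measure_Un_le) (auto simp: psum_cong_PiM)
    also have "measure (gauss n p) (\<Union>i\<in>{..<n}. ?B i) \<le> (\<Sum>i<n. measure (gauss n p) (?B i))"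
      using meas_B by (intro finite_measure_subadditive_finite) (auto simp: psum_cong_PiM)
    also have "\<dots> \<le> (\<Sum>i<n. exp (- (J1 * real n powr r)) * W)"
      using tail by (intro sum_mono) auto
    finally show ?thesis using A_le by simp
  qed
  have e: "0 < J1 - K" using K by simp
  have 1: "\<forall>\<^sub>F n in sequentially. real n * W \<le> exp ((J1 - K) * real n powr r)"
    using r e by real_asymp
  have 2: "\<forall>\<^sub>F n in sequentially. C * real n powr (2 * r - 1) \<le> (J1 - K) * real n powr r"
    using r e by real_asymp
  have 3: "\<forall>\<^sub>F n in sequentially. ln 2 \<le> (K - J) * real n powr r"
  proof -
    have "0 < K - J" using K by simp
    then show ?thesis using r by real_asymp
  qed
  from 1 2 3 eventually_gt_at_top[of 0] show ?thesis
  proof eventually_elim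
    case (elim n)
    have e2: "exp (C * real n powr (2 * r - 1) - J1 * real n powr r) \<le> exp (- (K * real n powr r))"
      using elim(2) by (simp add: algebra_simps)
    have "real n * (exp (- (J1 * real n powr r)) * W) = exp (- (J1 * real n powr r)) * (real n * W)" by simp
    also have "\<dots> \<le> exp (- (J1 * real n powr r)) * exp ((J1 - K) * real n powr r)"
      using elim by (intro mult_left_mono) auto
    also have "\<dots> = exp (- (K * real n powr r))" by (simp add: algebra_simps flip: exp_add)
    finally have "measure (gauss n p) {y \<in> space (leb n). real n * x \<le> psum n q y} \<le> 2 * exp (- (K * real n powr r))"
      using main[OF elim(4)] e2 by linarith
    also have "\<dots> = exp (ln 2 - K * real n powr r)" by (simp add: exp_diff exp_minus field_simps)
    also have "\<dots> \<le> exp (- (J * real n powr r))" using elim(3) by (simp add: algebra_simps)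
    finally show ?case by (simp add: r_def)
  qed
qed

text \<open>Keep only the interval [a, a + 1], on which the density is smallest at the right end.
  The shift by 1 is invisible at leading order for large a.\<close>

lemma gen_gaussian_tail_ge:
  assumes p: "p > 0" and a: "a \<ge> 0"
  shows "exp (- ((a + 1) powr p / p)) / (2 * p powr (1 / p) * Gamma (1 + 1 / p)) \<le> measure (gen_gaussian p) {y. a \<le> \<bar>y\<bar>}"
proof -
  define Z where "Z = 2 * p powr (1 / p) * Gamma (1 + 1 / p)"
  have Z: "Z > 0" using gen_gaussian_const_pos[OF p] by (simp add: Z_def)
  interpret prob_space "gen_gaussian p" by (rule prob_space_gen_gaussian) fact
  have "ennreal (exp (- ((a + 1) powr p / p)) / Z) = (\<integral>\<^sup>+y. ennreal (exp (- ((a + 1) powr p / p)) / Z) * indicator {a..a+1} y \<partial>lborel)"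
    by (simp add: nn_integral_cmult_indicator)
  also have "\<dots> \<le> (\<integral>\<^sup>+y. ennreal (exp (- (\<bar>y\<bar> powr p / p)) / Z) * indicator {y. a \<le> \<bar>y\<bar>} y \<partial>lborel)"
  proof (rule nn_integral_mono)
    fix y :: real
    show "ennreal (exp (- ((a + 1) powr p / p)) / Z) * indicator {a..a+1} y
      \<le> ennreal (exp (- (\<bar>y\<bar> powr p / p)) / Z) * indicator {y. a \<le> \<bar>y\<bar>} y"
    proof (cases "y \<in> {a..a+1}")
      case True
      then have "\<bar>y\<bar> powr p \<le> (a + 1) powr p" using a p by (intro powr_mono2) auto
      then show ?thesis using True a Z p by (auto intro!: ennreal_leI divide_right_mono)
    qed simp
  qed
  also have "\<dots> = emeasure (gen_gaussian p) {y. a \<le> \<bar>y\<bar>}"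
    unfolding gen_gaussian_def Z_def by (subst emeasure_density) auto
  finally show ?thesis unfolding Z_def by (simp add: emeasure_eq_measure)
qed

text \<open>The first coordinate contributes at least \<open>E n\<close> with \<open>E\<close> slightly above \<open>x - M\<close>, and the others
  supply \<open>(M - \<delta>) n\<close> with probability close to 1.\<close>
lemma gauss_psum_heavy_lower:
  assumes p: "p > 0" and pq: "p < q" and x: "M_p p q \<le> x" and J: "(x - M_p p q) powr (p / q) / p < J"
  shows "\<forall>\<^sub>F n in sequentially.
    exp (- (J * real n powr (p / q))) \<le> measure (gauss n p) {y \<in> space (leb n). real n * x \<le> psum n q y}"
proof -
  define r where "r = p / q"
  define M where "M = M_p p q"
  define V where "V = (\<integral>y. \<bar>y\<bar> powr (2 * q) \<partial>gen_gaussian p)"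
  define Z where "Z = 2 * p powr (1 / p) * Gamma (1 + 1 / p)"
  have Z: "Z > 0" using gen_gaussian_const_pos[OF p] by (simp add: Z_def)
  have q: "q > 0" and r: "0 < r" "r < 1" using p pq by (auto simp: r_def)
  have M: "M > 0" using M_p_pos[of p q] p q by (simp add: M_def)
  have V: "V \<ge> 0" by (simp add: V_def)
  have J0: "J > 0" using J p by (smt (verit) divide_nonneg_pos powr_ge_zero)
  obtain E where E: "x - M < E" "E powr r / p < J"
  proof -
    have "x - M < (p * J) powr (1 / r)"
    proof -
      have "x - M = ((x - M) powr r) powr (1 / r)" using x r by (simp add: M_def powr_powr)
      also have "\<dots> < (p * J) powr (1 / r)"
        using J p q r by (intro powr_less_mono2) (auto simp: M_def r_def field_simps)
      finally show ?thesis .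
    qed
    then obtain E where E: "x - M < E" "E < (p * J) powr (1 / r)" using dense by blast
    then have "E powr r < ((p * J) powr (1 / r)) powr r" using x r by (intro powr_less_mono2) (auto simp: M_def)
    also have "\<dots> = p * J" using r p J0 by (simp add: powr_powr)
    finally show ?thesis using that E p by (simp add: field_simps)
  qed
  define \<delta> where "\<delta> = E - (x - M)"
  have \<delta>: "\<delta> > 0" "E > 0" using E x by (auto simp: \<delta>_def M_def)
  \<comment> \<open>Chernoff parameter for the remaining coordinates; the quadratic term takes at
    most half of the slack \<delta>.\<close>
  define t where "t = \<delta> / (2 * (V + 1))"
  have t: "t > 0" using V \<delta> by (simp add: t_def)
  have tV: "t * V \<le> \<delta> / 2"
  proof -
    have "t * V \<le> t * (V + 1)" using t by simp
    also have "\<dots> = \<delta> / 2" using V by (simp add: t_def divide_simps)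
    finally show ?thesis .
  qed
  interpret G: prob_space "gen_gaussian p" by (rule prob_space_gen_gaussian) fact
  let ?m = "1 - t * M + t\<^sup>2 * V"
  have m_int: "(\<integral>y. 1 - t * \<bar>y\<bar> powr q + t\<^sup>2 * \<bar>y\<bar> powr (2 * q) \<partial>gen_gaussian p) = ?m"
    using p q by (simp add: integrable_gen_gaussian_powr integral_gen_gaussian_powr M_def V_def G.prob_space[simplified])
  have m_int': "integrable (gen_gaussian p) (\<lambda>y. 1 - t * \<bar>y\<bar> powr q + t\<^sup>2 * \<bar>y\<bar> powr (2 * q))"
    using p q by (simp add: integrable_gen_gaussian_powr)
  have le: "exp (- t * \<bar>y\<bar> powr q) \<le> 1 - t * \<bar>y\<bar> powr q + t\<^sup>2 * \<bar>y\<bar> powr (2 * q)" for y :: real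
    using exp_le_quadratic_nonpos[of "- t * \<bar>y\<bar> powr q"] t by (simp add: power_mult_distrib powr_square)
  then have g0: "0 \<le> 1 - t * \<bar>y\<bar> powr q + t\<^sup>2 * \<bar>y\<bar> powr (2 * q)" for y :: real
    using exp_ge_zero order_trans by blast
  have m0: "0 \<le> ?m" unfolding m_int[symmetric] using g0 by (intro integral_nonneg_AE) auto
  have m_exp: "?m \<le> exp (t\<^sup>2 * V - t * M)" using exp_ge_add_one_self[of "t\<^sup>2 * V - t * M"] by linarith
  have main: "exp (- (((E * real n) powr (1 / q) + 1) powr p / p)) / Z * (1 - exp (t * M - real n * (t * \<delta> / 2)))
      \<le> measure (gauss n p) {y \<in> space (leb n). real n * x \<le> psum n q y}"
    if n: "n > 0" for n
  proof -
    interpret prob_space "gauss n p" by (rule prob_space_gauss) fact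
    define a where "a = (E * real n) powr (1 / q)"
    have a: "a \<ge> 0" by (simp add: a_def)
    let ?S = "{y \<in> space (leb n). real n * x \<le> psum n q y}"
    let ?T = "\<lambda>y. \<Sum>i\<in>{..<n} - {0}. \<bar>y i\<bar> powr q"
    let ?A = "{y \<in> space (leb n). a \<le> \<bar>y 0\<bar>}"
    \<comment> \<open>Instead of invoking independence of the first coordinate from the rest, the
      bad event \<open>?B\<close> is subtracted from \<open>?A\<close>. The product bound for
      \<open>?B\<close> carries the factor for the first coordinate, so this factor can be taken out
      of the difference.\<close>
    let ?B = "{y \<in> space (leb n). a \<le> \<bar>y 0\<bar> \<and> ?T y \<le> real n * (M - \<delta>)}"
    have comp: "(\<lambda>y. y i) \<in> borel_measurable (leb n)" if "i < n" for i
      using that measurable_component_singleton[of i "{..<n}" "\<lambda>_. lborel :: real measure"] by simp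
    have [measurable]: "(\<lambda>y. y 0) \<in> borel_measurable (leb n)" using n by (rule comp)
    have [measurable]: "?T \<in> borel_measurable (leb n)"
    proof (rule borel_measurable_sum)
      fix i assume "i \<in> {..<n} - {0}"
      then show "(\<lambda>y. \<bar>y i\<bar> powr q) \<in> borel_measurable (leb n)"
        by (intro measurable_compose[OF comp, of i "\<lambda>z. \<bar>z\<bar> powr q"]) auto
    qed
    have meas: "?A \<in> sets (leb n)" "?B \<in> sets (leb n)" by measurable
    have "?A - ?B \<subseteq> ?S"
    proof
      fix y assume y: "y \<in> ?A - ?B"
      have "E * real n = a powr q" using \<delta> n q by (simp add: a_def powr_powr)
      also have "\<dots> \<le> \<bar>y 0\<bar> powr q" using y a q by (intro powr_mono2) auto
      finally have "E * real n \<le> \<bar>y 0\<bar> powr q" .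
      moreover have "real n * (M - \<delta>) \<le> ?T y" using y by auto
      moreover have "psum n q y = \<bar>y 0\<bar> powr q + ?T y"
        unfolding psum_def using n by (intro sum.remove) auto
      ultimately have "real n * x \<le> psum n q y" by (simp add: \<delta>_def algebra_simps)
      then show "y \<in> ?S" using y by auto
    qed
    then have "prob (?A - ?B) \<le> prob ?S" using meas by (intro finite_measure_mono) (auto simp: psum_cong_PiM)
    moreover have "prob (?A - ?B) = prob ?A - prob ?B"
      using meas by (intro finite_measure_Diff) (auto simp: psum_cong_PiM)
    moreover have prob_A: "prob ?A = G.prob {y. a \<le> \<bar>y\<bar>}"
    proof -
      have "G.prob {y. a \<le> \<bar>y\<bar>} = measure (distr (gauss n p) (gen_gaussian p) (\<lambda>y. y 0)) {y. a \<le> \<bar>y\<bar>}"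
        using n by (subst distr_PiM_component) (auto intro: G.prob_space_axioms)
      also have "\<dots> = prob ?A" using n by (subst measure_distr) (auto simp: psum_cong_PiM intro!: arg_cong[of _ _ prob])
      finally show ?thesis by simp
    qed
    moreover have "prob ?B \<le> G.prob {y. a \<le> \<bar>y\<bar>} * exp (t * M - real n * (t * \<delta> / 2))"
    proof -
      let ?f = "\<lambda>i y. if i = 0 then indicator {y. a \<le> \<bar>y\<bar>} y else 1 - t * \<bar>y\<bar> powr q + t\<^sup>2 * \<bar>y\<bar> powr (2 * q)"
      have split: "prod h {..<n} = h 0 * prod h ({..<n} - {0})" for h :: "nat \<Rightarrow> real"
        using n by (intro prod.remove) auto
      have "prob ?B \<le> exp (t * (real n * (M - \<delta>))) * (\<Prod>i<n. \<integral>y. ?f i y \<partial>gen_gaussian p)"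
      proof (rule measure_gauss_le_prod[OF p])
        show "integrable (gen_gaussian p) (?f i)" for i using m_int'
          by (cases "i = 0") (auto intro!: integrable_real_indicator simp: less_top[symmetric])
        fix y assume y: "y \<in> ?B"
        have "1 \<le> exp (t * (real n * (M - \<delta>))) * exp (- t * ?T y)"
          using y t by (auto simp flip: exp_add simp: mult_left_mono)
        also have "exp (- t * ?T y) = (\<Prod>i\<in>{..<n} - {0}. exp (- t * \<bar>y i\<bar> powr q))"
          by (simp add: exp_sum sum_distrib_left flip: sum_negf)
        also have "\<dots> \<le> (\<Prod>i\<in>{..<n} - {0}. ?f i (y i))"
          using le by (intro prod_mono) auto
        also have "\<dots> = (\<Prod>i<n. ?f i (y i))"
          using y by (simp add: split[of "\<lambda>i. ?f i (y i)"])
        finally show "1 \<le> exp (t * (real n * (M - \<delta>))) * (\<Prod>i<n. ?f i (y i))" by simp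
      qed (use meas g0 in auto)
      also have "(\<Prod>i<n. \<integral>y. ?f i y \<partial>gen_gaussian p) = G.prob {y. a \<le> \<bar>y\<bar>} * ?m ^ (n - 1)"
        using n by (subst split) (simp add: m_int card_Diff_singleton)
      also have "?m ^ (n - 1) \<le> exp (t\<^sup>2 * V - t * M) ^ (n - 1)" using m0 m_exp by (intro power_mono) auto
      also have "\<dots> = exp ((real n - 1) * (t\<^sup>2 * V - t * M))" using n by (simp add: of_nat_diff flip: exp_of_nat_mult)
      \<comment> \<open>The threshold counts n coordinates but only n - 1 contribute, which leaves
        over a constant of size at most \<open>t * M\<close>.\<close>
      also have "exp (t * (real n * (M - \<delta>))) * (G.prob {y. a \<le> \<bar>y\<bar>} * exp ((real n - 1) * (t\<^sup>2 * V - t * M)))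
        = G.prob {y. a \<le> \<bar>y\<bar>} * exp (t * (M - \<delta>) - (real n - 1) * (t * (\<delta> - t * V)))"
        by (simp add: algebra_simps power2_eq_square flip: exp_add)
      also have "\<dots> \<le> G.prob {y. a \<le> \<bar>y\<bar>} * exp (t * M - real n * (t * \<delta> / 2))"
      proof -
        have "(real n - 1) * (t * (\<delta> / 2)) \<le> (real n - 1) * (t * (\<delta> - t * V))"
          using n t tV by (intro mult_left_mono) (auto simp: field_simps)
        moreover have "t * \<delta> \<ge> 0" using t \<delta> by simp
        ultimately have "t * (M - \<delta>) - (real n - 1) * (t * (\<delta> - t * V)) \<le> t * M - real n * (t * \<delta> / 2)"
          by (simp add: algebra_simps diff_divide_distrib)
        then show ?thesis by (intro mult_left_mono) auto
      qed
      finally show ?thesis by (simp add: mult_left_mono mult_right_mono)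
    qed
    ultimately have *: "G.prob {y. a \<le> \<bar>y\<bar>} * (1 - exp (t * M - real n * (t * \<delta> / 2))) \<le> prob ?S"
      by (simp add: algebra_simps)
    show ?thesis
    proof (cases "exp (t * M - real n * (t * \<delta> / 2)) \<le> 1")
      case True
      have "exp (- ((a + 1) powr p / p)) / Z \<le> G.prob {y. a \<le> \<bar>y\<bar>}"
        unfolding Z_def by (rule gen_gaussian_tail_ge[OF p a])
      then have "exp (- ((a + 1) powr p / p)) / Z * (1 - exp (t * M - real n * (t * \<delta> / 2)))
        \<le> G.prob {y. a \<le> \<bar>y\<bar>} * (1 - exp (t * M - real n * (t * \<delta> / 2)))"
        using True by (intro mult_right_mono) auto
      then show ?thesis using * by (simp add: a_def)
    next
      case False
      then have "exp (- ((a + 1) powr p / p)) / Z * (1 - exp (t * M - real n * (t * \<delta> / 2))) \<le> 0"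
        using Z by (intro mult_nonneg_nonpos) auto
      then show ?thesis unfolding a_def by (rule order_trans) (rule measure_nonneg)
    qed
  qed
  \<comment> \<open>\<open>c powr p = E powr r < p * J\<close>: the strict gap absorbs the shift by
    1 and the constant factor 2 Z.\<close>
  define c where "c = E powr (1 / q)"
  have c: "c > 0" "c powr p < p * J" using \<delta> E p by (auto simp: c_def powr_powr r_def field_simps)
  have 1: "\<forall>\<^sub>F n in sequentially. (c * real n powr (1 / q) + 1) powr p + p * ln (2 * Z) \<le> (p * J) * real n powr (p / q)"
    using p pq c q by real_asymp
  have 2: "\<forall>\<^sub>F n in sequentially. exp (t * M - real n * (t * \<delta> / 2)) \<le> 1 / 2"
  proof -
    have "\<forall>\<^sub>F n in sequentially. exp (t * M - real n * d) \<le> 1 / 2" if "d > 0" for d :: real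
      using that by real_asymp
    from this[of "t * \<delta> / 2"] t \<delta> show ?thesis by (simp del: times_divide_eq_right)
  qed
  from 1 2 eventually_gt_at_top[of 0] show ?thesis
  proof eventually_elim
    case (elim n)
    have "(c * real n powr (1 / q) + 1) powr p / p + ln (2 * Z) \<le> J * real n powr (p / q)"
      using elim(1) p by (simp add: field_simps)
    then have "- (J * real n powr (p / q)) \<le> - ((c * real n powr (1 / q) + 1) powr p / p) - ln (2 * Z)" by simp
    then have "exp (- (J * real n powr (p / q))) \<le> exp (- ((c * real n powr (1 / q) + 1) powr p / p) - ln (2 * Z))" by simp
    also have "\<dots> = exp (- ((c * real n powr (1 / q) + 1) powr p / p)) / Z * (1 / 2)"
      using Z by (simp add: exp_diff)
    also have "\<dots> \<le> exp (- ((c * real n powr (1 / q) + 1) powr p / p)) / Z * (1 - exp (t * M - real n * (t * \<delta> / 2)))"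
      using elim(2) Z by (intro mult_left_mono) auto
    also have "\<dots> \<le> measure (gauss n p) {y \<in> space (leb n). real n * x \<le> psum n q y}"
      using main[OF elim(3)] \<delta> by (simp add: c_def powr_mult)
    finally show ?case .
  qed
qed

section \<open>Tails of the rescaled norm\<close>

text \<open>Power means, homogeneous of degree 1. Under \<open>gauss n p\<close> they concentrate at
  1 for the exponent p and at \<open>M_p p q powr (1 / q)\<close> for the exponent q.\<close>

definition nnorm :: "nat \<Rightarrow> real \<Rightarrow> (nat \<Rightarrow> real) \<Rightarrow> real" where
  "nnorm n p x = (psum n p x / real n) powr (1 / p)"

lemma nnorm_nonneg[simp]: "0 \<le> nnorm n p x"
  by (simp add: nnorm_def)

lemma measurable_nnorm[measurable]: "nnorm n s \<in> borel_measurable (leb n)"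
  unfolding nnorm_def by measurable

lemma nnorm_scale: "p > 0 \<Longrightarrow> r > 0 \<Longrightarrow> nnorm n p (\<lambda>i\<in>{..<n}. r * x i) = r * nnorm n p x"
  by (simp add: nnorm_def psum_scale powr_mult powr_divide powr_powr)

lemma powr_le_powr_iff:
  fixes a b s :: real
  assumes "a \<ge> 0" "b \<ge> 0" "s > 0" shows "a powr s \<le> b powr s \<longleftrightarrow> a \<le> b"
  using assms powr_mono2[of s a b] powr_less_mono2[of s b a] by (meson not_less less_imp_le)

lemma le_nnorm_iff:
  assumes "n > 0" "p > 0" "b \<ge> 0"
  shows "b \<le> nnorm n p x \<longleftrightarrow> real n * b powr p \<le> psum n p x"
proof -
  have "b \<le> nnorm n p x \<longleftrightarrow> (b powr p) powr (1 / p) \<le> (psum n p x / real n) powr (1 / p)"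
    using assms by (simp add: nnorm_def powr_powr)
  also have "\<dots> \<longleftrightarrow> b powr p \<le> psum n p x / real n"
    using assms by (intro powr_le_powr_iff) auto
  finally show ?thesis using assms by (simp add: field_simps)
qed

lemma nnorm_le_iff:
  assumes "n > 0" "p > 0" "b \<ge> 0"
  shows "nnorm n p x \<le> b \<longleftrightarrow> psum n p x \<le> real n * b powr p"
proof -
  have "nnorm n p x \<le> b \<longleftrightarrow> (psum n p x / real n) powr (1 / p) \<le> (b powr p) powr (1 / p)"
    using assms by (simp add: nnorm_def powr_powr)
  also have "\<dots> \<longleftrightarrow> psum n p x / real n \<le> b powr p"
    using assms by (intro powr_le_powr_iff) auto
  finally show ?thesis using assms by (simp add: field_simps)
qed

lemma psum_le_iff_nnorm:
  assumes "n > 0" "p > 0" "\<sigma> \<ge> 0"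
  shows "psum n p x \<le> \<sigma> powr p \<longleftrightarrow> nnorm n p x \<le> \<sigma> * real n powr (- 1 / p)"
proof -
  have "(real n powr (- 1 / p)) powr p = 1 / real n"
    using assms powr_minus_divide[of "real n" 1] by (simp add: powr_powr)
  then have "real n * (\<sigma> * real n powr (- 1 / p)) powr p = \<sigma> powr p"
    using assms by (simp add: powr_mult)
  then show ?thesis using assms by (subst nnorm_le_iff) auto
qed

definition scaled_norm :: "nat \<Rightarrow> real \<Rightarrow> real \<Rightarrow> (nat \<Rightarrow> real) \<Rightarrow> real" where
  "scaled_norm n p q x = real n powr (1 / p - 1 / q) * lp_norm n q x"

lemma scaled_norm_eq: "n > 0 \<Longrightarrow> scaled_norm n p q x = real n powr (1 / p) * nnorm n q x"
  by (simp add: scaled_norm_def lp_norm_def nnorm_def powr_diff powr_divide flip: psum_def)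

lemma scaled_norm_le_iff:
  "n > 0 \<Longrightarrow> scaled_norm n p q x \<le> t \<longleftrightarrow> nnorm n q x \<le> t * real n powr (- 1 / p)"
  by (simp add: scaled_norm_eq powr_minus field_simps)

lemma le_scaled_norm_iff:
  "n > 0 \<Longrightarrow> t \<le> scaled_norm n p q x \<longleftrightarrow> t * real n powr (- 1 / p) \<le> nnorm n q x"
  by (simp add: scaled_norm_eq powr_minus field_simps)

lemma measurable_scaled_norm[measurable]: "scaled_norm n p q \<in> borel_measurable (leb n)"
  unfolding scaled_norm_def lp_norm_def psum_def[symmetric] by measurable

text \<open>Both norms scale by the same factor, so comparing them ignores the radius; these are the
  events that \<open>unif_cone\<close> transfers.\<close>

lemma cone_ratio:
  assumes "p > 0" "q > 0"
  shows "cone n {x \<in> space (leb n). t * nnorm n p x \<le> nnorm n q x}"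
    and "cone n {x \<in> space (leb n). nnorm n q x \<le> t * nnorm n p x}"
proof -
  have "(\<lambda>i\<in>{..<n}. r * x i) \<in> space (leb n)" for r and x :: "nat \<Rightarrow> real"
    by (simp add: space_PiM)
  then show "cone n {x \<in> space (leb n). t * nnorm n p x \<le> nnorm n q x}"
    and "cone n {x \<in> space (leb n). nnorm n q x \<le> t * nnorm n p x}"
    using assms unfolding cone_def by (simp_all add: nnorm_scale mult.left_commute)
qed

section \<open>Comparison of the ball with the ratio of norms in a fixed dimension\<close>

context
  fixes p q :: real and n :: nat
  assumes p: "p > 0" and q: "q > 0" and n: "n > 0"
begin

text \<open>On the ball \<open>nnorm n p x\<close> is at most \<open>real n powr (- 1 / p)\<close>,
  so the event implies the ratio event with the same t.\<close>

lemma unif_upper_tail_le: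
  assumes t: "t \<ge> 0"
  shows "measure (unif_lp_ball n p) {x \<in> space (leb n). t \<le> scaled_norm n p q x}
    \<le> measure (gauss n p) {x \<in> space (leb n). t * nnorm n p x \<le> nnorm n q x}"
proof -
  interpret prob_space "unif_lp_ball n p" using p by (rule prob_space_unif)
  let ?C = "{x \<in> space (leb n). t * nnorm n p x \<le> nnorm n q x}"
  have B: "lp_ball n p \<in> sets (leb n)" unfolding lp_ball_eq[OF p] by measurable
  have "AE x in unif_lp_ball n p. x \<in> lp_ball n p"
    unfolding unif_lp_ball_def using B by (intro AE_uniform_measureI) auto
  then have "AE x in unif_lp_ball n p. x \<in> {x \<in> space (leb n). t \<le> scaled_norm n p q x} \<longrightarrow> x \<in> ?C"
  proof eventually_elim
    case (elim x)
    then have "nnorm n p x \<le> real n powr (- 1 / p)"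
      using psum_le_iff_nnorm[OF n p, of 1] by (simp add: lp_ball_eq[OF p])
    then have "t * nnorm n p x \<le> t * real n powr (- 1 / p)" using t by (rule mult_left_mono)
    then show ?case using n by (auto simp: le_scaled_norm_iff)
  qed
  then have "prob {x \<in> space (leb n). t \<le> scaled_norm n p q x} \<le> prob ?C"
    using p q by (intro finite_measure_mono_AE) auto
  then show ?thesis using unif_cone[OF p cone_ratio(1)[OF p q]] by simp
qed

lemma unif_psum_le:
  assumes "0 < \<sigma>" "\<sigma> \<le> 1" "cone n C"
  shows "measure (unif_lp_ball n p) (C \<inter> {x. psum n p x \<le> \<sigma> powr p}) = \<sigma> ^ n * measure (gauss n p) C"
proof -
  have "\<sigma> powr p \<le> 1" using powr_mono2[of p \<sigma> 1] assms p by simp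
  then show ?thesis
    using assms p by (simp add: unif_cone_psum_le powr_powr powr_realpow)
qed

lemma unif_upper_tail_ge:
  assumes t: "t \<ge> 0" and \<sigma>: "0 < \<sigma>" "\<sigma> < 1"
  shows "(1 - \<sigma> ^ n) * measure (gauss n p) {x \<in> space (leb n). t / \<sigma> * nnorm n p x \<le> nnorm n q x}
    \<le> measure (unif_lp_ball n p) {x \<in> space (leb n). t \<le> scaled_norm n p q x}"
proof -
  interpret prob_space "unif_lp_ball n p" using p by (rule prob_space_unif)
  let ?C = "{x \<in> space (leb n). t / \<sigma> * nnorm n p x \<le> nnorm n q x}"
  let ?D = "?C \<inter> {x. psum n p x \<le> \<sigma> powr p}"
  have D: "?D = ?C \<inter> {x \<in> space (leb n). psum n p x \<le> \<sigma> powr p}" by auto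
  have Dm: "?D \<in> sets (leb n)" unfolding D by (intro sets.Int psum_set) measurable
  have "(1 - \<sigma> ^ n) * measure (gauss n p) ?C = prob ?C - prob ?D"
    using \<sigma> unif_cone[OF p cone_ratio(1)[OF p q], of n "t / \<sigma>"]
      unif_psum_le[OF _ _ cone_ratio(1)[OF p q], of \<sigma> "t / \<sigma>"]
    by (simp add: algebra_simps)
  also have "\<dots> = prob (?C - ?D)" using Dm by (intro finite_measure_Diff[symmetric]) auto
  also have "\<dots> \<le> prob {x \<in> space (leb n). t \<le> scaled_norm n p q x}"
  proof (intro finite_measure_mono subsetI)
    fix x assume x: "x \<in> ?C - ?D"
    then have "\<sigma> * real n powr (- 1 / p) \<le> nnorm n p x"
      using psum_le_iff_nnorm[OF n p, of \<sigma> x] \<sigma> by auto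
    then have "t / \<sigma> * (\<sigma> * real n powr (- 1 / p)) \<le> t / \<sigma> * nnorm n p x"
      using t \<sigma> by (intro mult_left_mono) auto
    also have "\<dots> \<le> nnorm n q x" using x by auto
    finally show "x \<in> {x \<in> space (leb n). t \<le> scaled_norm n p q x}"
      using x \<sigma> n by (simp add: le_scaled_norm_iff)
  qed auto
  finally show ?thesis .
qed

text \<open>A point is either in the inner ball of radius \<sigma> or has p-norm above \<sigma>, and
  then the ratio of the norms is at most t / \<sigma>.\<close>

lemma unif_lower_tail_le:
  assumes t: "t \<ge> 0" and \<sigma>: "0 < \<sigma>" "\<sigma> < 1"
  shows "measure (unif_lp_ball n p) {x \<in> space (leb n). scaled_norm n p q x \<le> t}
    \<le> \<sigma> ^ n + measure (gauss n p) {x \<in> space (leb n). nnorm n q x \<le> t / \<sigma> * nnorm n p x}"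
proof -
  interpret prob_space "unif_lp_ball n p" using p by (rule prob_space_unif)
  interpret G: prob_space "gauss n p" using p by (rule prob_space_gauss)
  let ?C = "{x \<in> space (leb n). nnorm n q x \<le> t / \<sigma> * nnorm n p x}"
  let ?D = "space (leb n) \<inter> {x. psum n p x \<le> \<sigma> powr p}"
  have D: "?D = {x \<in> space (leb n). psum n p x \<le> \<sigma> powr p}" by auto
  have [measurable]: "?D \<in> sets (leb n)" unfolding D by measurable
  have "prob {x \<in> space (leb n). scaled_norm n p q x \<le> t} \<le> prob (?D \<union> ?C)"
  proof (intro finite_measure_mono subsetI)
    fix x assume x: "x \<in> {x \<in> space (leb n). scaled_norm n p q x \<le> t}"
    show "x \<in> ?D \<union> ?C"
    proof (cases "x \<in> ?D")
      case False
      then have "\<sigma> * real n powr (- 1 / p) \<le> nnorm n p x"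
        using psum_le_iff_nnorm[OF n p, of \<sigma> x] \<sigma> x by auto
      then have "t / \<sigma> * (\<sigma> * real n powr (- 1 / p)) \<le> t / \<sigma> * nnorm n p x"
        using t \<sigma> by (intro mult_left_mono) auto
      moreover have "nnorm n q x \<le> t * real n powr (- 1 / p)" using x n by (simp add: scaled_norm_le_iff)
      ultimately show ?thesis using x \<sigma> by auto
    qed simp
  qed auto
  also have "\<dots> \<le> prob ?D + prob ?C" by (intro measure_Un_le) auto
  also have "prob ?D = \<sigma> ^ n"
    using \<sigma> G.prob_space by (simp add: unif_psum_le cone_space psum_cong_PiM)
  also have "prob ?C = measure (gauss n p) ?C"
    using p q by (intro unif_cone cone_ratio) auto
  finally show ?thesis .
qed

text \<open>Either the denominator is at most \<beta>, or the numerator is at least t \<beta>. For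
  \<beta> < 1 the first alternative is atypical. The next two lemmas split in the same way.\<close>

lemma gauss_ratio_ge:
  assumes t: "t \<ge> 0" and \<beta>: "\<beta> \<ge> 0"
  shows "measure (gauss n p) {x \<in> space (leb n). t * nnorm n p x \<le> nnorm n q x}
    \<le> measure (gauss n p) {x \<in> space (leb n). psum n p x \<le> real n * \<beta> powr p}
      + measure (gauss n p) {x \<in> space (leb n). real n * (t * \<beta>) powr q \<le> psum n q x}"
    (is "measure _ ?A \<le> measure _ ?B + measure _ ?C")
proof -
  interpret prob_space "gauss n p" using p by (rule prob_space_gauss)
  have "prob ?A \<le> prob (?B \<union> ?C)"
  proof (intro finite_measure_mono subsetI)
    fix x assume x: "x \<in> ?A"
    show "x \<in> ?B \<union> ?C"
    proof (cases "nnorm n p x \<le> \<beta>")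
      case False
      then have "t * \<beta> \<le> t * nnorm n p x" using t by (intro mult_left_mono) auto
      then have "t * \<beta> \<le> nnorm n q x" using x by auto
      then show ?thesis using x t \<beta> le_nnorm_iff[OF n q] by auto
    qed (use x \<beta> nnorm_le_iff[OF n p] in auto)
  qed (simp add: psum_cong_PiM)
  also have "\<dots> \<le> prob ?B + prob ?C" by (intro measure_Un_le) (simp_all add: psum_cong_PiM)
  finally show ?thesis .
qed

lemma gauss_ratio_le:
  assumes t: "t \<ge> 0" and \<beta>: "\<beta> \<ge> 0"
  shows "measure (gauss n p) {x \<in> space (leb n). nnorm n q x \<le> t * nnorm n p x}
    \<le> measure (gauss n p) {x \<in> space (leb n). real n * \<beta> powr p \<le> psum n p x}
      + measure (gauss n p) {x \<in> space (leb n). psum n q x \<le> real n * (t * \<beta>) powr q}"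
    (is "measure _ ?A \<le> measure _ ?B + measure _ ?C")
proof -
  interpret prob_space "gauss n p" using p by (rule prob_space_gauss)
  have "prob ?A \<le> prob (?B \<union> ?C)"
  proof (intro finite_measure_mono subsetI)
    fix x assume x: "x \<in> ?A"
    show "x \<in> ?B \<union> ?C"
    proof (cases "\<beta> \<le> nnorm n p x")
      case False
      then have "t * nnorm n p x \<le> t * \<beta>" using t by (intro mult_left_mono) auto
      then have "nnorm n q x \<le> t * \<beta>" using x by auto
      then show ?thesis using x t \<beta> nnorm_le_iff[OF n q] by auto
    qed (use x \<beta> le_nnorm_iff[OF n p] in auto)
  qed (simp add: psum_cong_PiM)
  also have "\<dots> \<le> prob ?B + prob ?C" by (intro measure_Un_le) (simp_all add: psum_cong_PiM)
  finally show ?thesis .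
qed

text \<open>A large numerator makes the ratio large unless the denominator exceeds \<beta>, which is
  atypical for \<beta> > 1.\<close>

lemma gauss_psum_minus_le_ratio:
  assumes t: "t \<ge> 0" and \<beta>: "\<beta> \<ge> 0"
  shows "measure (gauss n p) {x \<in> space (leb n). real n * (t * \<beta>) powr q \<le> psum n q x}
      - measure (gauss n p) {x \<in> space (leb n). real n * \<beta> powr p \<le> psum n p x}
    \<le> measure (gauss n p) {x \<in> space (leb n). t * nnorm n p x \<le> nnorm n q x}"
    (is "measure _ ?C - measure _ ?B \<le> measure _ ?A")
proof -
  interpret prob_space "gauss n p" using p by (rule prob_space_gauss)
  have "prob ?C \<le> prob (?A \<union> ?B)"
  proof (intro finite_measure_mono subsetI)
    fix x assume x: "x \<in> ?C"
    show "x \<in> ?A \<union> ?B"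
    proof (cases "\<beta> \<le> nnorm n p x")
      case False
      then have "t * nnorm n p x \<le> t * \<beta>" using t by (intro mult_left_mono) auto
      moreover have "t * \<beta> \<le> nnorm n q x" using x t \<beta> le_nnorm_iff[OF n q] by auto
      ultimately show ?thesis using x by auto
    qed (use x \<beta> le_nnorm_iff[OF n p] in auto)
  qed (simp add: psum_cong_PiM)
  also have "\<dots> \<le> prob ?A + prob ?B" by (intro measure_Un_le) (simp_all add: psum_cong_PiM)
  finally show ?thesis by simp
qed

end

section \<open>Tail asymptotics and the conclusion\<close>

text \<open>Here r < 1 decides: a linear exponent beats every multiple of n^r. The factor a reserves
  a fixed share of the target for each error term.\<close>

lemma eventually_exp_linear_le:
  assumes "0 < r" "r < 1" "0 < (c::real)" "0 < a"
  shows "\<forall>\<^sub>F n in sequentially. exp (- (c * real n)) \<le> a * exp (- (K * real n powr r))"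
proof -
  have "\<forall>\<^sub>F n in sequentially. K * real n powr r - ln a \<le> c * real n"
    using assms by real_asymp
  then show ?thesis
  proof eventually_elim
    case (elim n)
    then have "exp (- (c * real n)) \<le> exp (ln a - K * real n powr r)" by simp
    then show ?case using assms by (simp add: exp_diff exp_minus field_simps)
  qed
qed

lemma measure_distr_scaled_norm:
  assumes "A \<in> sets borel"
  shows "measure (distr (unif_lp_ball n p) borel (scaled_norm n p q)) A
    = measure (unif_lp_ball n p) {x \<in> space (leb n). scaled_norm n p q x \<in> A}"
  using assms by (subst measure_distr) (auto intro!: arg_cong[of _ _ "measure (unif_lp_ball n p)"])

lemma tail_asymptotics_scaled_norm:
  fixes p q :: real
  assumes p: "0 < p" and pq: "p < q"
  defines "M \<equiv> M_p p q"
  shows "tail_asymptotics (\<lambda>n. distr (unif_lp_ball n p) borel (scaled_norm n p q))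
    (\<lambda>n. real n powr (p / q)) (\<lambda>z. 1 / p * (z powr q - M) powr (p / q)) (M powr (1 / q))"
proof -
  define r where "r = p / q"
  define m where "m = M powr (1 / q)"
  define f where "f z = 1 / p * (z powr q - M) powr r" for z
  have q: "q > 0" and r: "0 < r" "r < 1" using p pq by (auto simp: r_def)
  have M: "M > 0" using M_p_pos[of p q] p q by (simp add: M_def)
  have m: "m > 0" "m powr q = M" using M q by (auto simp: m_def powr_powr)
  have mq: "M < z powr q" if "m < z" for z using powr_less_mono2[of q m z] that m q by auto
  have mq': "M \<le> z powr q" if "m \<le> z" for z using powr_mono2[of q m z] that m q by auto
  have f_m: "f m = 0" using m by (simp add: f_def)
  have f_mono: "strict_mono_on {m..} f"
  proof (rule strict_mono_onI)
    fix a b assume ab: "a \<in> {m..}" "b \<in> {m..}" "a < b"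
    have "a powr q < b powr q" using ab m q by (intro powr_less_mono2) auto
    then show "f a < f b"
      unfolding f_def using ab p r mq'[of a] by (intro mult_strict_left_mono powr_less_mono2) auto
  qed
  have f_less: "f x < f y \<longleftrightarrow> x < y" if "m \<le> x" "m \<le> y" for x y
    using strict_mono_on_less[OF f_mono] that by auto
  have f_onto: "\<exists>b\<ge>m. f b = y" if y: "0 \<le> y" for y
  proof (intro exI conjI)
    \<comment> \<open>The explicit inverse of the rate on \<open>{m..}\<close>.\<close>
    let ?b = "(M + (p * y) powr (1 / r)) powr (1 / q)"
    show "m \<le> ?b" unfolding m_def using M q by (intro powr_mono2) auto
    have "?b powr q = M + (p * y) powr (1 / r)" using M q by (simp add: powr_powr add_pos_nonneg)
    then show "f ?b = y" using p r y by (simp add: f_def powr_powr)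
  qed
  have ex: "\<exists>b\<ge>m. f b = y \<and> (\<forall>x\<ge>m. (x < b \<longleftrightarrow> f x < y) \<and> (b < x \<longleftrightarrow> y < f x))" if "0 \<le> y" for y
    using f_onto[OF that] f_less by blast
  have f_ge0: "0 \<le> f x" for x using p by (simp add: f_def)
  note ev_exp = eventually_exp_linear_le[OF r]
  have s_top: "filterlim (\<lambda>n. real n powr r) at_top sequentially" using r by real_asymp
  have upper: "\<forall>\<^sub>F n in sequentially. measure (unif_lp_ball n p) {x \<in> space (leb n). t \<le> scaled_norm n p q x} \<le> exp (- (J * real n powr r))"
    if t: "m < t" and J: "J < f t" for t J
  proof -
    have "0 < f t" using f_less[of m t] t by (simp add: f_m)
    \<comment> \<open>A positive y has a preimage u strictly between m and t. The ratio u / t < 1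
      becomes the slack \<beta> in the denominator while \<open>f u\<close> still exceeds
      \<open>J\<close>.\<close>
    then obtain y where y: "max 0 J < y" "y < f t" using J dense[of "max 0 J" "f t"] by auto
    obtain u where u: "m \<le> u" "f u = y" "u < t" using ex[of y] y t by force
    have mu: "m < u" using u y f_m by (cases "m = u") auto
    obtain K where K: "J < K" "K < f u" using dense[of J y] y u by auto
    define \<beta> where "\<beta> = u / t"
    have \<beta>: "0 < \<beta>" "\<beta> < 1" "t * \<beta> = u" using u m t by (auto simp: \<beta>_def)
    have "\<beta> powr p < M_p p p" using \<beta> p powr_less_mono2[of p \<beta> 1] by (simp add: M_p_self)
    then obtain c where c: "c > 0"
      "\<And>n. measure (gauss n p) {x \<in> space (leb n). psum n p x \<le> real n * \<beta> powr p} \<le> exp (- (c * real n))"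
      using gauss_psum_lower_tail[of p p "\<beta> powr p"] p by auto
    have "\<forall>\<^sub>F n in sequentially. measure (gauss n p) {x \<in> space (leb n). real n * u powr q \<le> psum n q x} \<le> exp (- (K * real n powr r))"
      using gauss_psum_heavy_upper[OF p pq, of "u powr q" K] mq[OF mu] K by (simp add: M_def f_def r_def)
    with ev_exp[OF c(1) zero_less_one, of K] eventually_half_exp_le[OF s_top K(1)] eventually_gt_at_top[of 0]
    show ?thesis
    proof eventually_elim
      case (elim n)
      have "measure (unif_lp_ball n p) {x \<in> space (leb n). t \<le> scaled_norm n p q x}
        \<le> measure (gauss n p) {x \<in> space (leb n). t * nnorm n p x \<le> nnorm n q x}"
        using m t elim by (intro unif_upper_tail_le p q) auto
      also have "\<dots> \<le> measure (gauss n p) {x \<in> space (leb n). psum n p x \<le> real n * \<beta> powr p}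
        + measure (gauss n p) {x \<in> space (leb n). real n * (t * \<beta>) powr q \<le> psum n q x}"
        using m t elim \<beta> by (intro gauss_ratio_ge p q) auto
      finally show ?case using c(2)[of n] elim unfolding \<beta>(3) by linarith
    qed
  qed
  have lower: "\<forall>\<^sub>F n in sequentially. exp (- (J * real n powr r)) \<le> measure (unif_lp_ball n p) {x \<in> space (leb n). t \<le> scaled_norm n p q x}"
    if t: "m < t" and J: "f t < J" for t J
  proof -
    obtain y where y: "f t < y" "y < J" using J dense by auto
    obtain u where u: "m \<le> u" "f u = y" "t < u" using ex[of y] y t f_ge0[of t] by force
    obtain K where K: "f u < K" "K < J" using dense[of y J] y u by auto
    \<comment> \<open>Two factors 2 are lost, hence two gaps: one for subtracting the atypical
      denominator, one for the factor 1 - \<open>\<sigma> ^ n\<close>.\<close>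
    obtain K' where K': "K < K'" "K' < J" using dense[OF K(2)] by auto
    \<comment> \<open>The slack u / t is shared equally: one factor \<beta> pays for the inner ball
      of radius \<sigma> = 1 / \<beta>, the other for the Gaussian denominator.\<close>
    define \<beta> where "\<beta> = sqrt (u / t)"
    have \<beta>: "1 < \<beta>" "t / (1 / \<beta>) * \<beta> = u" using u m t by (auto simp: \<beta>_def mult.assoc)
    have "1 < \<beta> powr p" using \<beta> p powr_less_mono2[of p 1 \<beta>] by simp
    then obtain c where c: "c > 0"
      "\<And>n. measure (gauss n p) {x \<in> space (leb n). real n * \<beta> powr p \<le> psum n p x} \<le> exp (- (c * real n))"
      using gauss_psum_upper_tail[OF p, of "\<beta> powr p"] by auto
    have heavy: "\<forall>\<^sub>F n in sequentially. exp (- (K * real n powr r)) \<le> measure (gauss n p) {x \<in> space (leb n). real n * u powr q \<le> psum n q x}"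
      using gauss_psum_heavy_lower[OF p pq, of "u powr q" K] mq'[OF u(1)] K by (simp add: M_def f_def r_def)
    have pow: "\<forall>\<^sub>F n in sequentially. (1 / \<beta>) ^ n \<le> 1 / 2"
    proof -
      have "(\<lambda>n. (1 / \<beta>) ^ n) \<longlonglongrightarrow> 0" using \<beta> by (intro LIMSEQ_power_zero) auto
      then have "\<forall>\<^sub>F n in sequentially. (1 / \<beta>) ^ n < 1 / 2" by (rule order_tendstoD) simp
      then show ?thesis by eventually_elim simp
    qed
    from heavy pow ev_exp[OF c(1) half_gt_zero[OF zero_less_one], of K] eventually_half_exp_le[OF s_top K'(1)]
      eventually_half_exp_le[OF s_top K'(2)] eventually_gt_at_top[of 0]
    show ?thesis
    proof eventually_elim
      case (elim n)
      let ?R = "measure (gauss n p) {x \<in> space (leb n). t / (1 / \<beta>) * nnorm n p x \<le> nnorm n q x}"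
      have "measure (gauss n p) {x \<in> space (leb n). real n * (t / (1 / \<beta>) * \<beta>) powr q \<le> psum n q x}
        - measure (gauss n p) {x \<in> space (leb n). real n * \<beta> powr p \<le> psum n p x} \<le> ?R"
        using m t elim \<beta> by (intro gauss_psum_minus_le_ratio p q) auto
      then have "2 * exp (- (J * real n powr r)) \<le> ?R"
        using elim(1,3,4,5) c(2)[of n] unfolding \<beta>(2) by linarith
      moreover have "1 / 2 * ?R \<le> (1 - (1 / \<beta>) ^ n) * ?R"
        using elim by (intro mult_right_mono) auto
      moreover have "(1 - (1 / \<beta>) ^ n) * ?R \<le> measure (unif_lp_ball n p) {x \<in> space (leb n). t \<le> scaled_norm n p q x}"
        using m t \<beta> elim by (intro unif_upper_tail_ge p q) auto
      ultimately show ?case by linarith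
    qed
  qed
  have low: "\<forall>\<^sub>F n in sequentially. measure (unif_lp_ball n p) {x \<in> space (leb n). scaled_norm n p q x \<le> t} \<le> exp (- (J * real n powr r))"
    if t: "t < m" for t J
  proof -
    \<comment> \<open>t may be nonpositive, but the comparison divides by it; t0 is positive and
      still below m.\<close>
    define t0 where "t0 = max t (m / 2)"
    define u where "u = (t0 + m) / 2"
    have t0: "0 < t0" "t \<le> t0" "t0 < u" "u < m" using t m by (auto simp: t0_def u_def)
    define \<beta> where "\<beta> = sqrt (u / t0)"
    have \<beta>: "1 < \<beta>" "t0 / (1 / \<beta>) * \<beta> = u" using t0 by (auto simp: \<beta>_def mult.assoc)
    have "1 < \<beta> powr p" using \<beta> p powr_less_mono2[of p 1 \<beta>] by simp
    then obtain c where c: "c > 0"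
      "\<And>n. measure (gauss n p) {x \<in> space (leb n). real n * \<beta> powr p \<le> psum n p x} \<le> exp (- (c * real n))"
      using gauss_psum_upper_tail[OF p, of "\<beta> powr p"] by auto
    have "u powr q < M" using powr_less_mono2[of q u m] t0 q m by auto
    then obtain d where d: "d > 0"
      "\<And>n. measure (gauss n p) {x \<in> space (leb n). psum n q x \<le> real n * u powr q} \<le> exp (- (d * real n))"
      using gauss_psum_lower_tail[of p q "u powr q"] p q by (auto simp: M_def)
    have "ln \<beta> > 0" using \<beta> by simp
    \<comment> \<open>Inner ball, denominator and numerator each receive a third. All three decay
      like \<open>exp (- c n)\<close>, so \<open>J\<close> can be arbitrary.\<close>
    have third: "0 < (1 / 3 :: real)" by simp
    from ev_exp[OF \<open>ln \<beta> > 0\<close> third, of J] ev_exp[OF c(1) third, of J] ev_exp[OF d(1) third, of J] eventually_gt_at_top[of 0]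
    show ?thesis
    proof eventually_elim
      case (elim n)
      interpret prob_space "unif_lp_ball n p" using p by (rule prob_space_unif)
      have "prob {x \<in> space (leb n). scaled_norm n p q x \<le> t} \<le> prob {x \<in> space (leb n). scaled_norm n p q x \<le> t0}"
        using t0 by (intro finite_measure_mono) auto
      also have "\<dots> \<le> (1 / \<beta>) ^ n + measure (gauss n p) {x \<in> space (leb n). nnorm n q x \<le> t0 / (1 / \<beta>) * nnorm n p x}"
        using t0 \<beta> elim by (intro unif_lower_tail_le p q) auto
      also have "measure (gauss n p) {x \<in> space (leb n). nnorm n q x \<le> t0 / (1 / \<beta>) * nnorm n p x}
        \<le> measure (gauss n p) {x \<in> space (leb n). real n * \<beta> powr p \<le> psum n p x}
          + measure (gauss n p) {x \<in> space (leb n). psum n q x \<le> real n * (t0 / (1 / \<beta>) * \<beta>) powr q}"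
        using t0 \<beta> elim by (intro gauss_ratio_le p q) auto
      also have "(1 / \<beta>) ^ n = exp (- (ln \<beta> * real n))"
        using \<beta> by (simp add: exp_minus power_one_over inverse_eq_divide exp_of_nat2_mult)
      finally show ?case using elim c(2)[of n] d(2)[of n] unfolding \<beta>(2) by linarith
    qed
  qed
  show ?thesis
    unfolding r_def[symmetric] m_def[symmetric] f_def[symmetric]
  proof (rule tail_asymptotics.intro)
    show "prob_space (distr (unif_lp_ball n p) borel (scaled_norm n p q))" for n
      using prob_space_unif[OF p] by (intro prob_space.prob_space_distr) auto
    show "\<forall>\<^sub>F n in sequentially. measure (distr (unif_lp_ball n p) borel (scaled_norm n p q)) {t..} \<le> exp (- (J * real n powr r))"
      if "m < t" "J < f t" for t J
      using upper[OF that] by (simp add: measure_distr_scaled_norm)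
    show "\<forall>\<^sub>F n in sequentially. exp (- (J * real n powr r)) \<le> measure (distr (unif_lp_ball n p) borel (scaled_norm n p q)) {t..}"
      if "m < t" "f t < J" for t J
      using lower[OF that] by (simp add: measure_distr_scaled_norm)
    show "\<forall>\<^sub>F n in sequentially. measure (distr (unif_lp_ball n p) borel (scaled_norm n p q)) {..t} \<le> exp (- (J * real n powr r))"
      if "t < m" for t J
      using low[OF that] by (simp add: measure_distr_scaled_norm)
  qed (use s_top f_mono f_m f_onto in auto)
qed

theorem theorem1p3:
  fixes p q :: real
  assumes "1 \<le> p" and "p < q"
  shows "LDP (\<lambda>n. distr (unif_lp_ball n p) borel
                 (\<lambda>x. real n powr (1 / p - 1 / q) * lp_norm n q x))
             (\<lambda>n. real n powr (p / q)) (rate_1p3 p q)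
       \<and> good_rate (rate_1p3 p q)"
proof -
  interpret tail_asymptotics "\<lambda>n. distr (unif_lp_ball n p) borel (scaled_norm n p q)"
    "\<lambda>n. real n powr (p / q)" "\<lambda>z. 1 / p * (z powr q - M_p p q) powr (p / q)" "M_p p q powr (1 / q)"
    using assms by (intro tail_asymptotics_scaled_norm) auto
  have "rate = rate_1p3 p q" by (rule ext) (simp only: rate_def rate_1p3_def)
  then show ?thesis using LDP_rate good_rate_rate by (simp add: scaled_norm_def[abs_def])
qed

end
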